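(* (i) Let $F \subset \mathbb{Z}^2$ be a non-empty finite set, let $E \subset \mathbb{Z}^2$ be a periodic set, and let $A \subset \mathbb{Z}^2$ be a level one tiling of $E$ by $F$, i.e. $\mathbf{1}_F * \mathbf{1}_A = \mathbf{1}_E$. Then $A$ is weakly periodic. (ii) There exist a set $F \subset \mathbb{Z}^2$ with exactly eight elements and a set $A \subset \mathbb{Z}^2$ such that $A$ is a level $4$ tiling of $\mathbb{Z}^2$ by $F$, i.e. $\mathbf{1}_F * \mathbf{1}_A = 4$ identically on $\mathbb{Z}^2$, and $A$ is not weakly periodic.
   Context: $\mathbf{1}_S$ denotes the indicator function of a set $S$, and $f*g(x) = \sum_{y \in \mathbb{Z}^2} f(y) g(x-y)$ for functions on $\mathbb{Z}^2$ with $f$ finitely supported. For $k \ge 1$, a finite set $F\subset\mathbb{Z}^2$ and a set $E \subset \mathbb{Z}^2$, a tiling of level $k$ of $E$ by $F$ is a set $A \subset \mathbb{Z}^2$ with $\mathbf{1}_F * \mathbf{1}_A = k \mathbf{1}_E$. A set $S \subset \mathbb{Z}^2$ is $\Lambda$-periodic, for a subgroup $\Lambda \le \mathbb{Z}^2$, if $\mathbf{1}_S(x+\lambda) = \mathbf{1}_S(x)$ for all $x \in \mathbb{Z}^2$, $\lambda \in \Lambda$. It is periodic if it is $\Lambda$-periodic for some subgroup $\Lambda$ of finite index in $\mathbb{Z}^2$. It is weakly periodic if it is a disjoint union $S = S_1 \uplus \dots \uplus S_m$ of finitely many sets such that each $S_j$ is $\langle h_j \rangle$-periodic for some non-zero $h_j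 \in \mathbb{Z}^2$, where $\langle h_j\rangle = \{n h_j : n \in \mathbb{Z}\}$. *)

theory Defs
  imports "HOL-Algebra.Elementary_Groups" "HOL-Library.Product_Plus" "HOL-Library.Indicator_Function"
begin

type_synonym lattice = "int \<times> int"

definition Z2 :: "lattice monoid" where
  "Z2 = integer_group \<times>\<times> integer_group"

lemma group_Z2: "group Z2"
  by (simp add: Z2_def DirProd_group)

lemma carrier_Z2 [simp]: "carrier Z2 = UNIV"
  by (simp add: Z2_def DirProd_def)

lemma mult_Z2 [simp]: "x \<otimes>\<^bsub>Z2\<^esub> y = x + y"
  by (cases x; cases y) (simp add: Z2_def)

(* Meaningful only for finitely supported f: the sum over an infinite support is 0 by convention. *)
definition conv :: "(lattice \<Rightarrow> int) \<Rightarrow> (lattice \<Rightarrow> int) \<Rightarrow> lattice \<Rightarrow> int" where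
  "conv f g x = (\<Sum>y | f y \<noteq> 0. f y * g (x - y))"

(* Intended for k >= 1 and finite F. *)
definition level_tiling :: "nat \<Rightarrow> lattice set \<Rightarrow> lattice set \<Rightarrow> lattice set \<Rightarrow> bool" where
  "level_tiling k F E A \<longleftrightarrow>
     conv (indicator F) (indicator A) = (\<lambda>x. int k * indicator E x)"

definition periodic_wrt :: "lattice set \<Rightarrow> lattice set \<Rightarrow> bool" where
  "periodic_wrt \<Lambda> S \<longleftrightarrow>
     (\<forall>x. \<forall>l\<in>\<Lambda>. (indicator S (x + l) :: int) = indicator S x)"

(* The index of a subgroup is its number of cosets. *)
definition periodic :: "lattice set \<Rightarrow> bool" where
  "periodic S \<longleftrightarrow>
     (\<exists>\<Lambda>. subgroup \<Lambda> Z2 \<and> finite (rcosets\<^bsub>Z2\<^esub> \<Lambda>) \<and> periodic_wrt \<Lambda> S)"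

definition multiples :: "lattice \<Rightarrow> lattice set" where
  "multiples h = {(n * fst h, n * snd h) | n. True}"

(* The pieces may be empty, and m = 0 is allowed; it only yields the empty set,
   which is also covered by m = 1. *)
definition weakly_periodic :: "lattice set \<Rightarrow> bool" where
  "weakly_periodic S \<longleftrightarrow>
     (\<exists>(m::nat) T. S = (\<Union>j\<in>{1..m}. T j) \<and> disjoint_family_on T {1..m} \<and>
        (\<forall>j\<in>{1..m}. \<exists>h. h \<noteq> 0 \<and> periodic_wrt (multiples h) (T j)))"

end

theory Submission
  imports Defs "HOL-Library.Poly_Mapping" "HOL-Complex_Analysis.Great_Picard"
    "HOL-Analysis.Kronecker_Approximation_Theorem"
begin

text \<open>
  Part (i). Modulo a prime \<open>p\<close>, the \<open>p\<close>-th convolution power of the indicator function of \<open>F\<close> is the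
  indicator function of the dilate \<open>p F\<close> (Frobenius). Hence a level one tiling of a periodic set by
  \<open>F\<close> is also a tiling by \<open>r F\<close> whenever \<open>r \<ge> 1\<close> is congruent to \<open>1\<close> modulo a suitable \<open>q\<close>
  (\<open>tiling_dilation\<close>). Once \<open>F\<close> is translated so that it contains \<open>0\<close>, each of these identities
  expresses \<open>1\<^sub>E - 1\<^sub>A\<close> as the sum, over the non-zero \<open>f \<in> F\<close>, of the translates of \<open>1\<^sub>A\<close> by \<open>r f\<close>.
  Averaging over \<open>r\<close> and passing to a limit turns the \<open>f\<close>-th summand into a non-negative function
  with period \<open>q f\<close> (\<open>dilation_average\<close>), and adding up the summands with parallel periods leaves
  non-negative functions \<open>\<psi> h\<close>, one for each of finitely many pairwise non-parallel periods \<open>h\<close>,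
  with sum \<open>1\<^sub>E - 1\<^sub>A\<close>.

  The sum takes only the values \<open>0\<close> and \<open>1\<close>, and this is very restrictive
  (\<open>zero_one_sum_coset_periodic\<close>). Where \<open>\<psi> h\<close> is positive, the sum equals \<open>1\<close> on an entire line in
  direction \<open>h\<close>, so the other summands add up to a constant there. Comparing two such
  lines in the same coset of a sublattice writes the difference of two values of \<open>\<psi> h\<close> as a sum of
  bounded coboundaries, and a constant of this form vanishes (\<open>bounded_coboundary_sum_eq_0\<close>). So
  \<open>\<psi> h\<close> has finite range. On the other hand \<open>\<psi> h\<close> is a polynomial modulo \<open>1\<close>, because the
  differences along the other periods annihilate the other summands; a polynomial modulo \<open>1\<close> with finite
  range is periodic (\<open>finite_range_periodic_mod_one\<close>). Hence every \<open>\<psi> h\<close> is constant modulo \<open>1\<close> on the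
  cosets of a lattice. On a given coset, either all summands are constant, or one of them attains the
  value \<open>1\<close>; in the second case it forces all the others to vanish there, since non-parallel lines
  meet. In both cases \<open>A\<close> has a non-zero period on the coset.

  Part (ii). For irrational \<open>\<alpha>\<close> let \<open>c(n, m) = {2 \<alpha> n} + {\<alpha> m} - {\<alpha> (2 n + m)}\<close>, with values in
  \<open>{0, 1}\<close>, be the carry in the addition of fractional parts. Its three terms are invariant under
  \<open>v\<^sub>1 = (0, 1)\<close>, \<open>v\<^sub>2 = (1, 0)\<close> and \<open>v\<^sub>3 = (1, -2)\<close>, and the character \<open>(-1) ^ (n + m)\<close> takes
  the value \<open>-1\<close> at all three vectors. So \<open>(-1) ^ (n + m) (c - 1/2)\<close>, with values \<open>1/2\<close> and \<open>-1/2\<close>,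
  is a sum of three functions, each antiperiodic along one of the vectors (the constant \<open>1/2\<close> may be
  absorbed into any term). The product of the three operators "identity plus translation by \<open>v\<^sub>i\<close>"
  annihilates it. This product is convolution with the indicator function of the eight subset
  sums of the \<open>v\<^sub>i\<close>, which gives a tiling of level \<open>4\<close> (\<open>carry_set_tiling\<close>). The set
  is not weakly periodic, since by Kronecker's theorem the carry takes the value \<open>1\<close> on
  every arithmetic progression \<open>x + 2 k h\<close>, with \<open>k\<close> an integer, for which \<open>x\<close> is not parallel to
  \<open>h\<close> (\<open>carry_set_not_weakly_periodic\<close>).
\<close>

section \<open>Lattice arithmetic\<close>

definition zscale :: "int \<Rightarrow> lattice \<Rightarrow> lattice" (infixr "\<cdot>" 75) where
  "n \<cdot> v = (n * fst v, n * snd v)"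

definition det2 :: "lattice \<Rightarrow> lattice \<Rightarrow> int" where
  "det2 v w = fst v * snd w - snd v * fst w"

lemma fst_zscale [simp]: "fst (n \<cdot> v) = n * fst v"
  and snd_zscale [simp]: "snd (n \<cdot> v) = n * snd v"
  by (simp_all add: zscale_def)

lemma zscale_add_left: "(m + n) \<cdot> v = m \<cdot> v + n \<cdot> v"
  and zscale_add_right: "n \<cdot> (v + w) = n \<cdot> v + n \<cdot> w"
  and zscale_diff_left: "(m - n) \<cdot> v = m \<cdot> v - n \<cdot> v"
  and zscale_diff_right: "n \<cdot> (v - w) = n \<cdot> v - n \<cdot> w"
  and zscale_zscale [simp]: "m \<cdot> n \<cdot> v = (m * n) \<cdot> v"
  and zscale_one [simp]: "1 \<cdot> v = v"
  and zscale_zero_left [simp]: "0 \<cdot> v = 0"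
  and zscale_zero_right [simp]: "n \<cdot> 0 = 0"
  by (simp_all add: prod_eq_iff algebra_simps)

lemma zscale_eq_0_iff [simp]: "n \<cdot> v = 0 \<longleftrightarrow> n = 0 \<or> v = 0"
  by (auto simp: prod_eq_iff)

lemma det2_commute: "det2 w v = - det2 v w"
  by (simp add: det2_def)

lemma det2_self [simp]: "det2 v v = 0"
  by (simp add: det2_def)

lemma det2_zscale_right [simp]: "det2 v (n \<cdot> w) = n * det2 v w"
  and det2_zscale_left [simp]: "det2 (n \<cdot> v) w = n * det2 v w"
  by (simp_all add: det2_def algebra_simps)

lemma cramer_det2: "det2 v w \<cdot> x = det2 x w \<cdot> v + det2 v x \<cdot> w"
  by (simp add: prod_eq_iff det2_def algebra_simps)

lemma period_multiple:
  assumes "\<And>x. g (x + h) = g x"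
  shows "g (x + n \<cdot> h) = g x"
proof (induction n arbitrary: x rule: int_induct[where k = 0])
  case base
  show ?case by simp
next
  case (step1 i)
  have "g (x + (i + 1) \<cdot> h) = g ((x + i \<cdot> h) + h)"
    by (simp add: zscale_add_left add.assoc)
  then show ?case using step1 assms by simp
next
  case (step2 i)
  have "g (x + (i - 1) \<cdot> h) = g ((x + (i - 1) \<cdot> h) + h)"
    using assms by simp
  also have "\<dots> = g (x + i \<cdot> h)"
    by (simp add: zscale_diff_left add.assoc)
  finally show ?case using step2 by simp
qed

section \<open>Bounded coboundaries\<close>

text \<open>
  Averaging along \<open>v j\<close> over \<open>K\<close> steps makes the \<open>j\<close>-th coboundary telescope to size \<open>2 B / K\<close> and
  keeps the remaining terms coboundaries with the same bound, so that induction on the index set applies.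
  The error \<open>e\<close> is there to absorb this loss.
\<close>

lemma bounded_coboundary_sum_le:
  fixes g :: "'i \<Rightarrow> 'a::ab_group_add \<Rightarrow> real"
  assumes "finite I" "\<And>i x. i \<in> I \<Longrightarrow> \<bar>g i x\<bar> \<le> B"
    and "\<And>x. \<bar>(\<Sum>i\<in>I. g i (x + v i) - g i x) - c\<bar> \<le> e"
  shows "\<bar>c\<bar> \<le> e"
  using assms
proof (induction I arbitrary: g e)
  case empty
  then show ?case by simp
next
  case (insert j I)
  define T where "T = ((+) (v j))"
  have T_add: "(T ^^ n) (x + w) = (T ^^ n) x + w" for n x w
    by (induction n) (auto simp: T_def algebra_simps)
  have B: "\<bar>g i x\<bar> \<le> B" if "i \<in> insert j I" for i x
    using insert.prems that by blast
  have "\<bar>c\<bar> \<le> e + 2 * B / real K" if K: "K > 0" for K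
  proof (rule insert.IH)
    let ?G = "\<lambda>i x. (\<Sum>n<K. g i ((T ^^ n) x)) / real K"
    show "\<bar>?G i x\<bar> \<le> B" if "i \<in> I" for i x
    proof -
      have "\<bar>\<Sum>n<K. g i ((T ^^ n) x)\<bar> \<le> (\<Sum>n<K. \<bar>g i ((T ^^ n) x)\<bar>)" by (rule sum_abs)
      also have "\<dots> \<le> (\<Sum>n<K. B)" by (rule sum_mono) (use that B in auto)
      finally show ?thesis using K by (simp add: divide_simps mult.commute)
    qed
    show "\<bar>(\<Sum>i\<in>I. ?G i (x + v i) - ?G i x) - c\<bar> \<le> e + 2 * B / real K" for x
    proof -
      let ?S = "\<lambda>n. (\<Sum>i\<in>insert j I. g i ((T ^^ n) x + v i) - g i ((T ^^ n) x)) - c"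
      have "(\<Sum>n<K. g j ((T ^^ n) x + v j) - g j ((T ^^ n) x))
          = (\<Sum>n<K. g j ((T ^^ Suc n) x) - g j ((T ^^ n) x))"
        by (simp add: T_def add.commute)
      also have "\<dots> = g j ((T ^^ K) x) - g j x"
        by (subst sum_lessThan_telescope) simp
      finally have tel: "(\<Sum>n<K. g j ((T ^^ n) x + v j) - g j ((T ^^ n) x)) = g j ((T ^^ K) x) - g j x" .
      have "real K * ((\<Sum>i\<in>I. ?G i (x + v i) - ?G i x) - c)
          = (\<Sum>i\<in>I. (\<Sum>n<K. g i ((T ^^ n) (x + v i))) - (\<Sum>n<K. g i ((T ^^ n) x))) - real K * c"
        using K by (simp add: right_diff_distrib sum_subtractf flip: sum_divide_distrib)
      also have "\<dots> = (\<Sum>n<K. (\<Sum>i\<in>I. g i ((T ^^ n) x + v i) - g i ((T ^^ n) x)) - c)"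
        by (simp add: sum_subtractf T_add sum.swap[of _ I])
      also have "\<dots> = (\<Sum>n<K. ?S n) - (g j ((T ^^ K) x) - g j x)"
        using insert.hyps unfolding tel[symmetric] by (simp add: sum_subtractf sum.distrib)
      finally have eq: "real K * ((\<Sum>i\<in>I. ?G i (x + v i) - ?G i x) - c)
          = (\<Sum>n<K. ?S n) - (g j ((T ^^ K) x) - g j x)" .
      have "\<bar>\<Sum>n<K. ?S n\<bar> \<le> (\<Sum>n<K. \<bar>?S n\<bar>)" by (rule sum_abs)
      also have "\<dots> \<le> (\<Sum>n<K. e)"
        by (rule sum_mono) (rule insert.prems(2))
      finally have "\<bar>\<Sum>n<K. ?S n\<bar> \<le> K * e" by simp
      with B[of j "(T ^^ K) x"] B[of j x]
      have "\<bar>real K * ((\<Sum>i\<in>I. ?G i (x + v i) - ?G i x) - c)\<bar> \<le> K * e + 2 * B"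
        unfolding eq by auto
      then have "real K * \<bar>(\<Sum>i\<in>I. ?G i (x + v i) - ?G i x) - c\<bar> \<le> real K * (e + 2 * B / real K)"
        using K by (simp add: abs_mult distrib_left)
      then show ?thesis using K by (simp only: mult_le_cancel_left_pos of_nat_0_less_iff)
    qed
  qed
  then have *: "\<bar>c\<bar> \<le> e + 2 * B / real (Suc K)" for K by blast
  have "(\<lambda>K. e + 2 * B * inverse (real (Suc K))) \<longlonglongrightarrow> e + 2 * B * 0"
    by (intro tendsto_intros LIMSEQ_inverse_real_of_nat)
  from LIMSEQ_le_const[OF this, of "\<bar>c\<bar>"] * show ?case
    by (auto simp: divide_inverse)
qed

corollary bounded_coboundary_sum_eq_0:
  fixes g :: "'i \<Rightarrow> 'a::ab_group_add \<Rightarrow> real"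
  assumes "finite I" "\<And>i x. i \<in> I \<Longrightarrow> \<bar>g i x\<bar> \<le> B"
    and "\<And>x. (\<Sum>i\<in>I. g i (x + v i) - g i x) = c"
  shows "c = 0"
  using bounded_coboundary_sum_le[of I g B v c 0] assms by simp

section \<open>The dilation lemma\<close>

text \<open>
  The Frobenius congruence is needed in a group ring over the integers, whose characteristic is \<open>0\<close>;
  it is therefore phrased as a divisibility.
\<close>

lemma dvd_frobenius_add:
  fixes x y :: "'a::comm_ring_1"
  assumes p: "prime (p::nat)"
  shows "of_nat p dvd (x + y) ^ p - (x ^ p + y ^ p)"
proof -
  have p0: "p > 0" using p prime_gt_0_nat by blast
  have "(x + y) ^ p = (\<Sum>k\<le>p. of_nat (p choose k) * x ^ k * y ^ (p - k))"
    by (rule binomial_ring)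
  also have "{..p} = insert 0 (insert p {1..<p})" using p0 by auto
  also have "(\<Sum>k\<in>\<dots>. of_nat (p choose k) * x ^ k * y ^ (p - k))
      = y ^ p + x ^ p + (\<Sum>k\<in>{1..<p}. of_nat (p choose k) * x ^ k * y ^ (p - k))"
    using p0 by simp
  finally have "(x + y) ^ p - (x ^ p + y ^ p) = (\<Sum>k\<in>{1..<p}. of_nat (p choose k) * x ^ k * y ^ (p - k))"
    by simp
  moreover have "of_nat p dvd (\<Sum>k\<in>{1..<p}. of_nat (p choose k) * x ^ k * y ^ (p - k))"
  proof (rule dvd_sum)
    fix k assume "k \<in> {1..<p}"
    then have "p dvd (p choose k)" by (intro dvd_choose_prime p) auto
    then show "of_nat p dvd of_nat (p choose k) * x ^ k * y ^ (p - k)"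
      by (metis dvd_mult2 of_nat_dvd_iff of_nat_mult dvd_def dvd_triv_left)
  qed
  ultimately show ?thesis by simp
qed

lemma dvd_frobenius_sum:
  fixes f :: "'i \<Rightarrow> 'a::comm_ring_1"
  assumes p: "prime (p::nat)" and "finite I"
  shows "of_nat p dvd (\<Sum>i\<in>I. f i) ^ p - (\<Sum>i\<in>I. f i ^ p)"
  using \<open>finite I\<close>
proof induction
  case empty
  then show ?case using prime_gt_0_nat[OF p] by (simp add: zero_power)
next
  case (insert i I)
  have "(\<Sum>i\<in>insert i I. f i) ^ p - (\<Sum>i\<in>insert i I. f i ^ p)
     = ((f i + (\<Sum>i\<in>I. f i)) ^ p - (f i ^ p + (\<Sum>i\<in>I. f i) ^ p))
       + ((\<Sum>i\<in>I. f i) ^ p - (\<Sum>i\<in>I. f i ^ p))"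
    using insert.hyps by simp
  then show ?case
    using dvd_add[OF dvd_frobenius_add[OF p] insert.IH] by metis
qed

text \<open>
  The action of the integral group ring of the lattice on functions by convolution: the basis
  element of \<open>k\<close> acts as translation by \<open>k\<close>.
\<close>

definition act :: "(lattice \<Rightarrow>\<^sub>0 int) \<Rightarrow> (lattice \<Rightarrow> int) \<Rightarrow> lattice \<Rightarrow> int" where
  "act P g x = (\<Sum>k\<in>Poly_Mapping.keys P. Poly_Mapping.lookup P k * g (x - k))"

lemma act_superset:
  assumes "finite S" "Poly_Mapping.keys P \<subseteq> S"
  shows "act P g x = (\<Sum>k\<in>S. Poly_Mapping.lookup P k * g (x - k))"
  unfolding act_def using assms
  by (intro sum.mono_neutral_left) (auto simp: in_keys_iff)

lemma act_diff: "act (P - Q) g x = act P g x - act Q g x"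
proof -
  let ?S = "Poly_Mapping.keys P \<union> Poly_Mapping.keys Q"
  have "Poly_Mapping.keys (P - Q) \<subseteq> ?S" by (rule keys_diff)
  then show ?thesis
    by (simp add: act_superset[where S = ?S] lookup_minus algebra_simps flip: sum_subtractf)
qed

lemma act_0 [simp]: "act 0 g x = 0"
  by (simp add: act_def)

lemma act_add: "act (P + Q) g x = act P g x + act Q g x"
  using act_diff[of "P + Q" Q g x] by simp

lemma act_sum: "act (\<Sum>i\<in>I. P i) g x = (\<Sum>i\<in>I. act (P i) g x)"
  by (induction I rule: infinite_finite_induct) (auto simp: act_add)

lemma act_single: "act (Poly_Mapping.single k c) g x = c * g (x - k)"
  by (simp add: act_superset[where S = "{k}"])

lemma act_mult_single:
  "act (Poly_Mapping.single k 1 * Q) g x = act Q g (x - k)"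
  using subset_UNIV[of "Poly_Mapping.keys Q"]
proof (induction Q arbitrary: x rule: frag_induction)
  case (one l)
  then show ?case by (simp add: mult_single act_single algebra_simps)
next
  case (diff a b)
  then show ?case by (simp add: right_diff_distrib act_diff)
qed auto

lemma act_mult: "act (P * Q) g x = act P (act Q g) x"
  using subset_UNIV[of "Poly_Mapping.keys P"]
proof (induction P arbitrary: x rule: frag_induction)
  case (one l)
  then show ?case by (simp add: act_mult_single act_single)
next
  case (diff a b)
  then show ?case by (simp add: left_diff_distrib act_diff)
qed auto

lemma act_of_nat: "act (of_nat n) g x = int n * g x"
  by (induction n) (auto simp: act_add algebra_simps act_single simp flip: single_one)

lemma single_power: "Poly_Mapping.single (k :: lattice) (1::int) ^ n = Poly_Mapping.single (int n \<cdot> k) 1"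
  by (induction n) (auto simp: mult_single zscale_add_left add.commute)

text \<open>
  By the Frobenius congruence the dilated sum is a multiple of \<open>p\<close>, and it is smaller than \<open>p\<close> in
  absolute value because it has only \<open>card F\<close> terms of size at most \<open>1\<close>.
\<close>

lemma dilation_prime:
  fixes g :: "lattice \<Rightarrow> int"
  assumes "finite F" and zero: "\<And>x. (\<Sum>f\<in>F. g (x - m \<cdot> f)) = 0"
    and bound: "\<And>x. \<bar>g x\<bar> \<le> 1" and p: "prime p" "card F < p"
  shows "(\<Sum>f\<in>F. g (x - (int p * m) \<cdot> f)) = 0"
proof -
  define X where "X f = Poly_Mapping.single (m \<cdot> f) (1::int)" for f
  obtain R where R: "(\<Sum>f\<in>F. X f) ^ p - (\<Sum>f\<in>F. X f ^ p) = of_nat p * R"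
    using dvd_frobenius_sum[OF p(1) \<open>finite F\<close>, of X] by (auto elim: dvdE)
  have act0: "act (\<Sum>f\<in>F. X f) g = (\<lambda>x. 0)"
    by (simp add: fun_eq_iff act_sum X_def act_single zero)
  have "act ((\<Sum>f\<in>F. X f) ^ p) g x = act ((\<Sum>f\<in>F. X f) ^ (p - 1)) (act (\<Sum>f\<in>F. X f) g) x"
    using prime_gt_0_nat[OF p(1)] by (subst act_mult[symmetric]) (simp add: power_eq_if mult.commute)
  also have "\<dots> = 0" unfolding act0 by (simp add: act_def)
  finally have "act (\<Sum>f\<in>F. X f ^ p) g x = - act (of_nat p * R) g x"
    unfolding R[symmetric] by (simp add: act_diff)
  then have "act (\<Sum>f\<in>F. X f ^ p) g x = - (int p * act R g x)"
    by (simp add: act_mult act_of_nat)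
  moreover have "act (\<Sum>f\<in>F. X f ^ p) g x = (\<Sum>f\<in>F. g (x - (int p * m) \<cdot> f))"
    by (simp add: act_sum X_def single_power act_single)
  ultimately have "int p dvd (\<Sum>f\<in>F. g (x - (int p * m) \<cdot> f))" by simp
  moreover have "\<bar>\<Sum>f\<in>F. g (x - (int p * m) \<cdot> f)\<bar> < int p"
  proof -
    have "\<bar>\<Sum>f\<in>F. g (x - (int p * m) \<cdot> f)\<bar> \<le> (\<Sum>f\<in>F. \<bar>g (x - (int p * m) \<cdot> f)\<bar>)"
      by (rule sum_abs)
    also have "\<dots> \<le> (\<Sum>f\<in>F. 1)" by (rule sum_mono) (rule bound)
    finally show ?thesis using p(2) by simp
  qed
  ultimately show ?thesis
    using zdvd_not_zless by (smt (verit) dvd_minus_iff)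
qed

text \<open>
  Coprimality with \<open>fact (card F)\<close> says that every prime factor of \<open>r\<close> exceeds \<open>card F\<close>, so that
  \<open>dilation_prime\<close> can be applied to one prime factor after the other.
\<close>

lemma dilation_coprime:
  fixes g :: "lattice \<Rightarrow> int"
  assumes "finite F" and zero: "\<And>x. (\<Sum>f\<in>F. g (x - f)) = 0"
    and bound: "\<And>x. \<bar>g x\<bar> \<le> 1" and "coprime r (fact (card F))"  and "r > 0"
  shows "(\<Sum>f\<in>F. g (x - int r \<cdot> f)) = 0"
  using \<open>coprime r (fact (card F))\<close> \<open>r > 0\<close>
proof (induction r arbitrary: x rule: less_induct)
  case (less r)
  show ?case
  proof (cases "r = 1")
    case True
    then show ?thesis using zero by simp
  next
    case False
    then obtain p where p: "prime p" "p dvd r" using prime_factor_nat by blast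
    then obtain s where s: "r = p * s" by blast
    have "\<not> p dvd fact (card F)"
      using less.prems(1) p coprime_common_divisor_nat not_prime_1 by metis
    then have "card F < p" using prime_dvd_fact_iff[OF p(1)] by auto
    have "s > 0" using less.prems s by (cases s) auto
    moreover have "s < r" using s prime_gt_1_nat[OF p(1)] \<open>s > 0\<close> by simp
    moreover have "coprime s (fact (card F))" using less.prems(1) s by simp
    ultimately have "(\<Sum>f\<in>F. g (x - int s \<cdot> f)) = 0" for x using less.IH by blast
    from dilation_prime[OF \<open>finite F\<close> this bound p(1) \<open>card F < p\<close>] s
    show ?thesis by simp
  qed
qed

text \<open>
  A subgroup of finite index contains a multiple of every vector, by the pigeonhole principle for the
  cosets of its multiples; the two unit vectors then yield a sublattice \<open>N \<int>\<^sup>2\<close>.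
\<close>

lemma periodic_common_multiple:
  assumes "periodic E"
  obtains N :: int where "N > 0" "\<And>x v. x + N \<cdot> v \<in> E \<longleftrightarrow> x \<in> E"
proof -
  from assms obtain L where L: "subgroup L Z2" "finite (rcosets\<^bsub>Z2\<^esub> L)" "periodic_wrt L E"
    unfolding periodic_def by blast
  have L_period: "x + l \<in> E \<longleftrightarrow> x \<in> E" if "l \<in> L" for x l
  proof -
    have "(indicator E (x + l) :: int) = indicator E x"
      using L(3) that unfolding periodic_wrt_def by blast
    then show ?thesis by (auto simp: indicator_def split: if_splits)
  qed
  have "\<one>\<^bsub>Z2\<^esub> = 0" by (simp add: Z2_def DirProd_def zero_prod_def)
  then have "0 \<in> L" using subgroup.one_closed[OF L(1)] by simp
  have ex: "\<exists>k>0. \<forall>x. x + k \<cdot> v \<in> E \<longleftrightarrow> x \<in> E" for v :: lattice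
  proof -
    let ?c = "\<lambda>n::nat. L #>\<^bsub>Z2\<^esub> (int n \<cdot> v)"
    have "range ?c \<subseteq> rcosets\<^bsub>Z2\<^esub> L" by (auto simp: RCOSETS_def)
    then have "finite (range ?c)" using L(2) finite_subset by blast
    then have "\<not> inj ?c" using finite_imageD[of ?c UNIV] infinite_UNIV_nat by blast
    then obtain m n where mn: "m < n" "?c m = ?c n"
      unfolding inj_def by (metis linorder_neqE_nat)
    have "0 + int n \<cdot> v \<in> ?c n" using \<open>0 \<in> L\<close> by (force simp: r_coset_def)
    then have "int n \<cdot> v \<in> ?c m" using mn by simp
    then obtain l where l: "l \<in> L" "int n \<cdot> v = l + int m \<cdot> v" by (auto simp: r_coset_def)
    then have "l = (int n - int m) \<cdot> v" by (simp add: zscale_diff_left)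
    then show ?thesis using L_period l(1) mn(1) by (intro exI[of _ "int n - int m"]) auto
  qed
  obtain k l where k: "k > 0" "\<And>x. x + k \<cdot> (1,0) \<in> E \<longleftrightarrow> x \<in> E"
    and l: "l > 0" "\<And>x. x + l \<cdot> (0,1) \<in> E \<longleftrightarrow> x \<in> E"
    using ex[of "(1,0)"] ex[of "(0,1)"] by blast
  show thesis
  proof (rule that)
    show "k * l > 0" using k l by simp
    fix x v :: lattice
    have "x + (k * l) \<cdot> v = (x + (l * fst v) \<cdot> (k \<cdot> (1,0))) + (k * snd v) \<cdot> (l \<cdot> (0,1))"
      by (simp add: prod_eq_iff)
    then show "x + (k * l) \<cdot> v \<in> E \<longleftrightarrow> x \<in> E"
      using period_multiple[where g = "\<lambda>x. x \<in> E", OF k(2)]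
        period_multiple[where g = "\<lambda>x. x \<in> E", OF l(2)] by metis
  qed
qed

text \<open>
  The differences of \<open>a\<close> along \<open>N \<int>\<^sup>2\<close> satisfy the homogeneous equation, so by \<open>dilation_coprime\<close> the
  dilated convolution is again \<open>N \<int>\<^sup>2\<close>-periodic. It differs from \<open>E\<close> by a constant on each
  coset, and this constant is a sum of coboundaries of \<open>a\<close> because \<open>r f - f\<close> lies in \<open>N \<int>\<^sup>2\<close>.
\<close>

lemma tiling_dilation:
  fixes a E :: "lattice \<Rightarrow> int" and N :: int
  assumes "finite F" and N: "N > 0"
    and E: "\<And>x v. E (x + N \<cdot> v) = E x" and a: "\<And>x. a x \<in> {0..1}"
    and tiling: "\<And>x. (\<Sum>f\<in>F. a (x - f)) = E x"
  shows "(\<Sum>f\<in>F. a (x - (1 + int n * (N * fact (card F))) \<cdot> f)) = E x"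
proof -
  define r where "r = 1 + n * (nat N * fact (card F))"
  have int_r: "int r = 1 + int n * (N * fact (card F))" using N by (simp add: r_def)
  have cop: "coprime r (fact (card F))" 
    unfolding r_def by (metis coprime_1_left coprime_iff_gcd_eq_1 gcd_add_mult gcd.commute mult.assoc add.commute)
  \<comment> \<open>Periodicity of the dilated convolution, from the homogeneous equation for differences of \<open>a\<close>.\<close>
  have w: "(\<Sum>f\<in>F. a (x + N \<cdot> y - int r \<cdot> f)) = (\<Sum>f\<in>F. a (x - int r \<cdot> f))" for y
  proof -
    have "(\<Sum>f\<in>F. a (x - int r \<cdot> f + N \<cdot> y) - a (x - int r \<cdot> f)) = 0"
    proof (rule dilation_coprime[where g = "\<lambda>x. a (x + N \<cdot> y) - a x", OF \<open>finite F\<close> _ _ cop])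
      show "(\<Sum>f\<in>F. a (x - f + N \<cdot> y) - a (x - f)) = 0" for x
        using tiling[of "x + N \<cdot> y"] tiling[of x] E
        by (simp add: sum_subtractf add_diff_eq diff_add_eq)
      show "\<bar>a (x + N \<cdot> y) - a x\<bar> \<le> 1" for x using a[of x] a[of "x + N \<cdot> y"] by auto
      show "r > 0" by (simp add: r_def)
    qed
    then show ?thesis by (simp add: sum_subtractf add_diff_eq diff_add_eq)
  qed
  define c where "c = real_of_int ((\<Sum>f\<in>F. a (x - int r \<cdot> f)) - E x)"
  have "c = 0"
  proof (rule bounded_coboundary_sum_eq_0[OF \<open>finite F\<close>])
    let ?g = "\<lambda>f y. real_of_int (a (x + N \<cdot> y - f))"
    show "\<bar>?g f y\<bar> \<le> 1" for f y using a[of "x + N \<cdot> y - f"] by auto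
    let ?v = "\<lambda>f. (- (int n * fact (card F))) \<cdot> f"
    show "(\<Sum>f\<in>F. ?g f (y + ?v f) - ?g f y) = c" for y
    proof -
      have eq: "x + N \<cdot> (y + ?v f) - f = x + N \<cdot> y - int r \<cdot> f" for f
        unfolding int_r by (simp add: prod_eq_iff algebra_simps)
      show ?thesis
        unfolding eq c_def using w[of y] tiling[of "x + N \<cdot> y"] E
        by (simp add: sum_subtractf flip: of_int_sum)
    qed
  qed
  then have "(\<Sum>f\<in>F. a (x - int r \<cdot> f)) - E x = 0" unfolding c_def by (simp only: of_int_eq_0_iff)
  then show ?thesis by (simp add: int_r)
qed

text \<open>
  For each \<open>f\<close>, the mean over \<open>n < K\<close> of the translates of \<open>a\<close> by \<open>(1 + n q) f\<close> changes by at most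
  \<open>1 / K\<close> under translation by \<open>q f\<close>. The means converge along a subsequence, simultaneously at all points.
\<close>

lemma dilation_average:
  fixes a E :: "lattice \<Rightarrow> int" and q :: int
  assumes "finite F" "0 \<in> F" and a: "\<And>x. a x \<in> {0..1}"
    and tiling: "\<And>n x. (\<Sum>f\<in>F. a (x - (1 + int n * q) \<cdot> f)) = E x"
  obtains \<phi> :: "lattice \<Rightarrow> lattice \<Rightarrow> real"
  where "\<And>f x. \<phi> f (x + q \<cdot> f) = \<phi> f x" "\<And>f x. \<phi> f x \<ge> 0"
    "\<And>x. (\<Sum>f\<in>F - {0}. \<phi> f x) = real_of_int (E x - a x)"
proof -
  define \<Phi> where "\<Phi> K p = (\<Sum>n<Suc K. real_of_int (a (snd p - (1 + int n * q) \<cdot> fst p))) / real (Suc K)"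
    for K and p :: "lattice \<times> lattice"
  have nonneg: "\<Phi> K p \<ge> 0" for K p
    unfolding \<Phi>_def using a by (intro divide_nonneg_nonneg sum_nonneg) auto
  have "\<Phi> K p \<le> 1" for K p
  proof -
    have "(\<Sum>n<Suc K. real_of_int (a (snd p - (1 + int n * q) \<cdot> fst p))) \<le> (\<Sum>n<Suc K. 1)"
      using a by (intro sum_mono) auto
    then show ?thesis unfolding \<Phi>_def by simp
  qed
  with nonneg have "norm (\<Phi> K p) \<le> 1" for K p by simp
  then have bounded: "norm (\<Phi> K p) \<le> 1" if "p \<in> UNIV" for K p by blast
  obtain k where k: "strict_mono k" "\<And>p. p \<in> UNIV \<Longrightarrow> \<exists>l. (\<lambda>K. \<Phi> (k K) p) \<longlonglongrightarrow> l"
    by (rule function_convergent_subsequence[where f = \<Phi> and S = UNIV and M = 1, OF countableI_type bounded])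
      (rule UNIV_I, erule that, blast)
  define \<phi> where "\<phi> f x = lim (\<lambda>K. \<Phi> (k K) (f, x))" for f x
  have lim: "(\<lambda>K. \<Phi> (k K) (f, x)) \<longlonglongrightarrow> \<phi> f x" for f x
    unfolding \<phi>_def using k(2)[of "(f, x)", OF UNIV_I] by (metis limI)
  have k_inf: "filterlim k sequentially sequentially" using k(1) by (rule filterlim_subseq)
  show thesis
  proof (rule that[of \<phi>])
    show "\<phi> f x \<ge> 0" for f x using lim nonneg by (metis LIMSEQ_le_const)
    show "\<phi> f (x + q \<cdot> f) = \<phi> f x" for f x
    proof -
      define b where "b n = real_of_int (a (x - (1 + (int n - 1) * q) \<cdot> f))" for n
      have b: "b n \<in> {0..1}" for n using a[of "x - (1 + (int n - 1) * q) \<cdot> f"] by (auto simp: b_def)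
      \<comment> \<open>Translation by \<open>q f\<close> shifts the sequence \<open>b\<close> by one step, so the difference telescopes.\<close>
      have b1: "real_of_int (a (x + q \<cdot> f - (1 + int n * q) \<cdot> f)) = b n" for n
      proof -
        have "x + q \<cdot> f - (1 + int n * q) \<cdot> f = x - (1 + (int n - 1) * q) \<cdot> f"
          by (simp add: prod_eq_iff algebra_simps)
        then show ?thesis by (simp only: b_def)
      qed
      have b2: "real_of_int (a (x - (1 + int n * q) \<cdot> f)) = b (Suc n)" for n
        by (simp add: b_def)
      have diff: "\<Phi> K (f, x + q \<cdot> f) - \<Phi> K (f, x) = (b 0 - b (Suc K)) / real (Suc K)" for K
      proof -
        have "(\<Sum>n<Suc K. b n) - (\<Sum>n<Suc K. b (Suc n)) = b 0 - b (Suc K)"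
          by (subst sum_subtractf[symmetric]) (rule sum_lessThan_telescope')
        then show ?thesis unfolding \<Phi>_def by (simp only: fst_conv snd_conv b1 b2 diff_divide_distrib[symmetric])
      qed
      have "(\<lambda>K. \<Phi> K (f, x + q \<cdot> f) - \<Phi> K (f, x)) \<longlonglongrightarrow> 0"
      proof (rule Lim_null_comparison)
        show "\<forall>\<^sub>F K in sequentially. norm (\<Phi> K (f, x + q \<cdot> f) - \<Phi> K (f, x)) \<le> inverse (real (Suc K))"
        proof (rule always_eventually, rule allI)
          fix K
          have "\<bar>b 0 - b (Suc K)\<bar> \<le> 1" using b[of 0] b[of "Suc K"] by auto
          then show "norm (\<Phi> K (f, x + q \<cdot> f) - \<Phi> K (f, x)) \<le> inverse (real (Suc K))"
            unfolding diff real_norm_def abs_divide inverse_eq_divide by (simp add: divide_right_mono)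
        qed
      qed (rule LIMSEQ_inverse_real_of_nat)
      then have "(\<lambda>K. \<Phi> (k K) (f, x + q \<cdot> f) - \<Phi> (k K) (f, x)) \<longlonglongrightarrow> 0"
        by (rule filterlim_compose[OF _ k_inf])
      moreover have "(\<lambda>K. \<Phi> (k K) (f, x + q \<cdot> f) - \<Phi> (k K) (f, x)) \<longlonglongrightarrow> \<phi> f (x + q \<cdot> f) - \<phi> f x"
        by (intro tendsto_diff lim)
      ultimately show ?thesis using LIMSEQ_unique by fastforce
    qed
    show "(\<Sum>f\<in>F - {0}. \<phi> f x) = real_of_int (E x - a x)" for x
    proof (rule LIMSEQ_unique)
      show "(\<lambda>K. \<Sum>f\<in>F - {0}. \<Phi> (k K) (f, x)) \<longlonglongrightarrow> (\<Sum>f\<in>F - {0}. \<phi> f x)"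
        by (intro tendsto_sum lim)
      have "(\<Sum>f\<in>F - {0}. \<Phi> K (f, x)) = real_of_int (E x - a x)" for K
      proof -
        have avg: "(\<Sum>f\<in>F - {0}. real_of_int (a (x - (1 + int n * q) \<cdot> f))) = real_of_int (E x - a x)" for n
          using tiling[of x n] sum.remove[OF \<open>finite F\<close> \<open>0 \<in> F\<close>, of "\<lambda>f. a (x - (1 + int n * q) \<cdot> f)"]
          by (simp flip: of_int_sum)
        have "(\<Sum>f\<in>F - {0}. \<Phi> K (f, x))
           = (\<Sum>n<Suc K. \<Sum>f\<in>F - {0}. real_of_int (a (x - (1 + int n * q) \<cdot> f))) / real (Suc K)"
          unfolding \<Phi>_def fst_conv snd_conv by (subst sum.swap) (simp add: sum_divide_distrib)
        also have "\<dots> = real_of_int (E x - a x)" unfolding avg by simp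
        finally show ?thesis .
      qed
      then show "(\<lambda>K. \<Sum>f\<in>F - {0}. \<Phi> (k K) (f, x)) \<longlonglongrightarrow> real_of_int (E x - a x)" by simp
    qed
  qed
qed

section \<open>Merging parallel periods\<close>

lemma parallel_common_multiple:
  assumes "det2 v w = 0" "v \<noteq> 0" "w \<noteq> 0"
  obtains m n where "m \<noteq> 0" "n \<noteq> 0" "m \<cdot> v = n \<cdot> w"
proof (cases "fst v = 0")
  case True
  then have "snd v \<noteq> 0" "fst w = 0" using assms by (auto simp: det2_def prod_eq_iff)
  then show ?thesis using True assms that[of "snd w" "snd v"] by (auto simp: prod_eq_iff)
next
  case False
  then have "fst w \<noteq> 0" using assms by (auto simp: det2_def prod_eq_iff)
  then show ?thesis using False assms that[of "fst w" "fst v"]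
    by (auto simp: det2_def prod_eq_iff algebra_simps)
qed

text \<open>
  In the induction step, if the new period is parallel to some \<open>h \<in> H\<close>, then \<open>h\<close> is replaced by a common
  multiple of both and the two functions are added; otherwise the new period joins \<open>H\<close>.
\<close>

lemma merge_parallel_periods:
  fixes \<phi> :: "'i \<Rightarrow> lattice \<Rightarrow> real"
  assumes "finite I" "\<And>i. i \<in> I \<Longrightarrow> p i \<noteq> 0" "\<And>i x. i \<in> I \<Longrightarrow> \<phi> i (x + p i) = \<phi> i x"
    "\<And>i x. i \<in> I \<Longrightarrow> \<phi> i x \<ge> 0"
  shows "\<exists>H \<psi>. finite H \<and> 0 \<notin> H \<and> (\<forall>h\<in>H. \<forall>k\<in>H. h \<noteq> k \<longrightarrow> det2 h k \<noteq> 0)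
    \<and> (\<forall>h\<in>H. \<forall>x. \<psi> h (x + h) = \<psi> h x \<and> \<psi> h x \<ge> 0)
    \<and> (\<forall>x. (\<Sum>h\<in>H. \<psi> h x) = (\<Sum>i\<in>I. \<phi> i x))"
  using assms
proof (induction I)
  case empty
  show ?case by (rule exI[of _ "{}"]) simp
next
  case (insert i I)
  have "\<exists>H \<psi>. finite H \<and> 0 \<notin> H \<and> (\<forall>h\<in>H. \<forall>k\<in>H. h \<noteq> k \<longrightarrow> det2 h k \<noteq> 0)
    \<and> (\<forall>h\<in>H. \<forall>x. \<psi> h (x + h) = \<psi> h x \<and> \<psi> h x \<ge> 0)
    \<and> (\<forall>x. (\<Sum>h\<in>H. \<psi> h x) = (\<Sum>i\<in>I. \<phi> i x))"
    using insert.prems by (intro insert.IH) auto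
  then obtain H \<psi> where IH: "finite H" "0 \<notin> H" "\<forall>h\<in>H. \<forall>k\<in>H. h \<noteq> k \<longrightarrow> det2 h k \<noteq> 0"
    "\<forall>h\<in>H. \<forall>x. \<psi> h (x + h) = \<psi> h x \<and> \<psi> h x \<ge> 0"
    "\<forall>x. (\<Sum>h\<in>H. \<psi> h x) = (\<Sum>i\<in>I. \<phi> i x)"
    by (elim exE conjE) (rule that)
  have H: "finite H" "0 \<notin> H" "\<And>h k. h \<in> H \<Longrightarrow> k \<in> H \<Longrightarrow> h \<noteq> k \<Longrightarrow> det2 h k \<noteq> 0"
    and \<psi>: "\<And>h x. h \<in> H \<Longrightarrow> \<psi> h (x + h) = \<psi> h x" "\<And>h x. h \<in> H \<Longrightarrow> \<psi> h x \<ge> 0"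
    and sum: "\<And>x. (\<Sum>h\<in>H. \<psi> h x) = (\<Sum>i\<in>I. \<phi> i x)"
    using IH by blast+
  show ?case
  proof (cases "\<exists>h\<in>H. det2 h (p i) = 0")
    case False
    then have new: "p i \<notin> H" using det2_self by blast
    have "det2 (p i) h \<noteq> 0" if "h \<in> H" for h using False that det2_commute[of "p i" h] by auto
    then have "\<forall>h\<in>insert (p i) H. \<forall>k\<in>insert (p i) H. h \<noteq> k \<longrightarrow> det2 h k \<noteq> 0"
      using H(3) False by auto
    moreover have "(\<Sum>h\<in>insert (p i) H. (\<psi>(p i := \<phi> i)) h x) = (\<Sum>i\<in>insert i I. \<phi> i x)" for x
    proof -
      have "(\<Sum>h\<in>H. (\<psi>(p i := \<phi> i)) h x) = (\<Sum>h\<in>H. \<psi> h x)"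
        using new by (intro sum.cong) auto
      then show ?thesis using new H(1) insert.hyps sum[of x] by simp
    qed
    moreover have "\<forall>h\<in>insert (p i) H. \<forall>x. (\<psi>(p i := \<phi> i)) h (x + h) = (\<psi>(p i := \<phi> i)) h x
        \<and> (\<psi>(p i := \<phi> i)) h x \<ge> 0"
      using \<psi> insert.prems(2,3) by simp
    moreover have "p i \<noteq> 0" using insert.prems(1) by simp
    ultimately show ?thesis
      using H(1,2) by (intro exI[of _ "insert (p i) H"] exI[of _ "\<psi>(p i := \<phi> i)"]) simp
  next
    case True
    then obtain h where h: "h \<in> H" "det2 h (p i) = 0" by blast
    then obtain m n where mn: "m \<noteq> 0" "n \<noteq> 0" "m \<cdot> h = n \<cdot> p i"
      using parallel_common_multiple[of h "p i"] H(2) insert.prems(1)[of i] by blast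
    define h' where "h' = m \<cdot> h"
    let ?H = "H - {h}"
    have nz: "det2 h' k \<noteq> 0" "det2 k h' \<noteq> 0" if "k \<in> ?H" for k
    proof -
      have "det2 h k \<noteq> 0" "det2 k h \<noteq> 0" using that h(1) H(3)[of h k] H(3)[of k h] by auto
      then show "det2 h' k \<noteq> 0" "det2 k h' \<noteq> 0" using mn(1) by (simp_all add: h'_def)
    qed
    then have new: "h' \<notin> ?H" using det2_self by blast
    have "h \<noteq> 0" using h(1) H(2) by blast
    then have "h' \<noteq> 0" using mn(1) by (simp add: h'_def)
    let ?\<psi> = "\<psi>(h' := (\<lambda>x. \<psi> h x + \<phi> i x))"
    have "\<psi> h (x + h') = \<psi> h x" for x
      unfolding h'_def using \<psi>(1)[OF h(1)] by (rule period_multiple)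
    moreover have "\<phi> i (x + h') = \<phi> i x" for x
      unfolding h'_def mn(3) using insert.prems(2)[of i] by (intro period_multiple) auto
    ultimately have per: "\<forall>k\<in>insert h' ?H. \<forall>x. ?\<psi> k (x + k) = ?\<psi> k x \<and> ?\<psi> k x \<ge> 0"
      using \<psi> h(1) insert.prems(3) by simp
    have "\<forall>x. (\<Sum>k\<in>insert h' ?H. ?\<psi> k x) = (\<Sum>j\<in>insert i I. \<phi> j x)"
    proof
      fix x
      have "(\<Sum>k\<in>insert h' ?H. ?\<psi> k x) = \<psi> h x + \<phi> i x + (\<Sum>k\<in>?H. ?\<psi> k x)"
        using new H(1) by simp
      also have "(\<Sum>k\<in>?H. ?\<psi> k x) = (\<Sum>k\<in>?H. \<psi> k x)"
        using new by (intro sum.cong) auto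
      finally show "(\<Sum>k\<in>insert h' ?H. ?\<psi> k x) = (\<Sum>j\<in>insert i I. \<phi> j x)"
        using sum.remove[OF H(1) h(1), of "\<lambda>k. \<psi> k x"] sum[of x] insert.hyps by simp
    qed
    moreover have "\<forall>h\<in>insert h' ?H. \<forall>k\<in>insert h' ?H. h \<noteq> k \<longrightarrow> det2 h k \<noteq> 0"
      using H(3) nz by simp
    moreover have "finite (insert h' ?H)" "0 \<notin> insert h' ?H" using H(1,2) \<open>h' \<noteq> 0\<close> by auto
    ultimately show ?thesis
      using per by (intro exI[of _ "insert h' ?H"] exI[of _ ?\<psi>] conjI)
  qed
qed

section \<open>Functions of finite range that are polynomial modulo one\<close>

lemma Ints_diff_iff_frac: "x - y \<in> \<int> \<longleftrightarrow> frac x = frac (y :: real)"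
proof
  assume "x - y \<in> \<int>"
  then obtain n where "x = y + of_int n" by (metis Ints_cases add.commute diff_add_cancel)
  then show "frac x = frac y" by (simp add: frac_def)
next
  assume "frac x = frac y"
  then have "x - y = of_int (\<lfloor>x\<rfloor> - \<lfloor>y\<rfloor>)" by (simp add: frac_def)
  then show "x - y \<in> \<int>" by (metis Ints_of_int)
qed

text \<open>
  Modulo \<open>1\<close>, the second difference of \<open>\<phi>\<close> along \<open>P c\<close> vanishes, so \<open>\<phi>\<close> is affine along the
  progressions \<open>x + m P c\<close>. If \<open>\<phi>\<close> has \<open>V\<close> values, two of the first \<open>V + 1\<close> terms coincide, so
  the slope is a rational number whose denominator divides \<open>fact V\<close>, uniformly in \<open>x\<close>.
\<close>

lemma finite_range_affine_mod_one:
  fixes \<phi> :: "lattice \<Rightarrow> real"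
  assumes fin: "finite (range \<phi>)" and "P > 0"
    and step: "\<And>x v. (\<phi> (x + P \<cdot> v + c) - \<phi> (x + P \<cdot> v)) - (\<phi> (x + c) - \<phi> x) \<in> \<int>"
  obtains Q where "Q > 0" "\<And>x. \<phi> (x + Q \<cdot> c) - \<phi> x \<in> \<int>"
proof -
  define d where "d x = \<phi> (x + c) - \<phi> x" for x
  define e where "e x = \<phi> (x + P \<cdot> c) - \<phi> x" for x
  have d: "d (x + P \<cdot> v) - d x \<in> \<int>" for x v using step unfolding d_def .
  have tele: "\<phi> (x + int n \<cdot> c) - \<phi> x = (\<Sum>i<n. d (x + int i \<cdot> c))" for x n
    by (induction n) (auto simp: d_def zscale_add_left algebra_simps)
  have e_sum: "e x = (\<Sum>i<nat P. d (x + int i \<cdot> c))" for x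
    using tele[of x "nat P"] \<open>P > 0\<close> by (simp add: e_def)
  have e: "e (x + P \<cdot> v) - e x \<in> \<int>" for x v
  proof -
    have "e (x + P \<cdot> v) - e x = (\<Sum>i<nat P. d ((x + int i \<cdot> c) + P \<cdot> v) - d (x + int i \<cdot> c))"
      unfolding e_sum by (simp add: sum_subtractf add.assoc add.commute[of "P \<cdot> v"])
    also have "\<dots> \<in> \<int>" by (intro Ints_sum d)
    finally show ?thesis .
  qed
  have affine: "\<phi> (x + (int m * P) \<cdot> c) - \<phi> x - real m * e x \<in> \<int>" for x m
  proof (induction m)
    case (Suc m)
    let ?y = "x + (int m * P) \<cdot> c"
    have "?y = x + P \<cdot> (int m \<cdot> c)" by (simp add: mult.commute)
    then have "e ?y - e x \<in> \<int>" using e by metis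
    moreover have "x + (int (Suc m) * P) \<cdot> c = ?y + P \<cdot> c"
      by (simp add: prod_eq_iff algebra_simps)
    then have "\<phi> (x + (int (Suc m) * P) \<cdot> c) = \<phi> ?y + e ?y" by (simp only: e_def)
    ultimately show ?case
      using Ints_add[OF Suc.IH, of "e ?y - e x"] by (simp add: algebra_simps)
  qed simp
  define V where "V = card (range \<phi>)"
  have int_e: "fact V * e x \<in> \<int>" for x
  proof -
    let ?f = "\<lambda>m. \<phi> (x + (int m * P) \<cdot> c)"
    have "card (?f ` {..V}) \<le> V"
      unfolding V_def by (rule card_mono[OF fin]) auto
    then have "\<not> inj_on ?f {..V}" by (metis card_image card_atMost not_less_eq_eq order_refl)
    then obtain m m' where m: "m < m'" "m' \<le> V" "?f m = ?f m'"
      unfolding inj_on_def by (metis atMost_iff linorder_neqE_nat)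
    have "real m' * e x - real m * e x \<in> \<int>"
      using Ints_diff[OF affine[of x m] affine[of x m']] m(3) by simp
    then have "real (m' - m) * e x \<in> \<int>" using m(1) by (simp add: algebra_simps of_nat_diff)
    moreover have "m' - m dvd fact V" using m by (intro dvd_fact) auto
    then obtain k where "fact V = (m' - m) * k" by blast
    then have "(fact V :: real) = real k * real (m' - m)"
      by (metis mult.commute of_nat_fact of_nat_mult)
    ultimately show ?thesis by (metis Ints_mult Ints_of_nat mult.assoc)
  qed
  show thesis
  proof (rule that)
    show "int (fact V) * P > 0" using \<open>P > 0\<close> by simp
    show "\<phi> (x + (int (fact V) * P) \<cdot> c) - \<phi> x \<in> \<int>" for x
      using Ints_add[OF affine[of x "fact V"] int_e[of x]] by simp
  qed
qed

text \<open>
  Taking the difference along \<open>c\<close> eliminates \<open>\<psi> c\<close> from the relation, and it preserves the finite range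
  and the period \<open>h\<close> of \<open>\<phi>\<close>. By induction that difference is periodic modulo \<open>1\<close>, whence \<open>\<phi>\<close> has
  modulo \<open>1\<close> a period parallel to \<open>c\<close>. Together with \<open>h\<close> this spans a lattice.
\<close>

lemma finite_range_periodic_mod_one:
  fixes \<phi> :: "lattice \<Rightarrow> real"
  assumes "finite K" "\<And>k. k \<in> K \<Longrightarrow> det2 h k \<noteq> 0"
    and "finite (range \<phi>)" "\<And>x. \<phi> (x + h) = \<phi> x"
    and "\<And>k x. k \<in> K \<Longrightarrow> \<psi> k (x + k) = \<psi> k x"
    and "\<And>x. \<phi> x + (\<Sum>k\<in>K. \<psi> k x) \<in> \<int>"
  shows "\<exists>P>0. \<forall>x v. \<phi> (x + P \<cdot> v) - \<phi> x \<in> \<int>"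
  using assms
proof (induction K arbitrary: \<phi> \<psi>)
  case empty
  then show ?case by (intro exI[of _ 1]) auto
next
  case (insert c K)
  let ?\<phi> = "\<lambda>x. \<phi> (x + c) - \<phi> x" and ?\<psi> = "\<lambda>k x. \<psi> k (x + c) - \<psi> k x"
  have "\<exists>P>0. \<forall>x v. ?\<phi> (x + P \<cdot> v) - ?\<phi> x \<in> \<int>"
  proof (rule insert.IH[of ?\<phi> ?\<psi>])
    have "range ?\<phi> \<subseteq> (\<lambda>(a, b). a - b) ` (range \<phi> \<times> range \<phi>)" by auto
    then show "finite (range ?\<phi>)"
      by (rule finite_subset) (intro finite_imageI finite_cartesian_product insert.prems(2))
    show "?\<phi> (x + h) = ?\<phi> x" for x
      using insert.prems(3)[of "x + c"] insert.prems(3)[of x] by (simp add: algebra_simps)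
    show "?\<psi> k (x + k) = ?\<psi> k x" if "k \<in> K" for k x
      using insert.prems(4)[of k "x + c"] insert.prems(4)[of k x] that by (simp add: algebra_simps)
    show "?\<phi> x + (\<Sum>k\<in>K. ?\<psi> k x) \<in> \<int>" for x
    proof -
      have eq: "?\<phi> x + (\<Sum>k\<in>K. ?\<psi> k x)
        = (\<phi> (x + c) + (\<Sum>k\<in>insert c K. \<psi> k (x + c))) - (\<phi> x + (\<Sum>k\<in>insert c K. \<psi> k x))"
        using insert.hyps insert.prems(4)[of c x] by (simp add: sum_subtractf)
      show ?thesis unfolding eq by (rule Ints_diff[OF insert.prems(5) insert.prems(5)])
    qed
  qed (use insert.prems(1) in auto)
  then obtain P where "P > 0" "\<And>x v. ?\<phi> (x + P \<cdot> v) - ?\<phi> x \<in> \<int>" by blast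
  then obtain Q where Q: "Q > 0" "\<And>x. \<phi> (x + Q \<cdot> c) - \<phi> x \<in> \<int>"
    using finite_range_affine_mod_one[OF insert.prems(2)] by blast
  define R where "R = Q * det2 h c"
  have "R \<noteq> 0" using Q(1) insert.prems(1)[of c] by (simp add: R_def)
  have fr: "frac (\<phi> (x + R \<cdot> v)) = frac (\<phi> x)" for x v
  proof -
    have "frac (\<phi> (x + n \<cdot> h)) = frac (\<phi> x)" for n x
      by (rule period_multiple[where g = "\<lambda>x. frac (\<phi> x)"]) (simp add: insert.prems(3))
    moreover have "frac (\<phi> (x + n \<cdot> Q \<cdot> c)) = frac (\<phi> x)" for n x
      by (rule period_multiple[where g = "\<lambda>x. frac (\<phi> x)"])
        (use Q(2) in \<open>simp flip: Ints_diff_iff_frac\<close>)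
    moreover have "x + R \<cdot> v = (x + (Q * det2 v c) \<cdot> h) + det2 h v \<cdot> Q \<cdot> c"
      by (simp add: R_def prod_eq_iff det2_def algebra_simps)
    ultimately show ?thesis by (simp only:)
  qed
  have "\<bar>R\<bar> \<cdot> v = R \<cdot> sgn R \<cdot> v" for v by (simp add: abs_sgn)
  then have "\<phi> (x + \<bar>R\<bar> \<cdot> v) - \<phi> x \<in> \<int>" for x v
    unfolding Ints_diff_iff_frac by (simp only: fr)
  then show ?case using \<open>R \<noteq> 0\<close> by (intro exI[of _ "\<bar>R\<bar>"]) auto
qed

section \<open>Rigidity of sums of singly periodic functions\<close>

text \<open>
  The rigidity of a sum of non-negative singly periodic functions with values in \<open>{0, 1}\<close>: on each
  coset of some sublattice \<open>D \<int>\<^sup>2\<close> it has a non-zero period, which depends on the coset.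
\<close>

lemma zero_one_sum_coset_periodic:
  fixes \<psi> :: "lattice \<Rightarrow> lattice \<Rightarrow> real"
  assumes "finite H" "0 \<notin> H" and indep: "\<And>h k. h \<in> H \<Longrightarrow> k \<in> H \<Longrightarrow> h \<noteq> k \<Longrightarrow> det2 h k \<noteq> 0"
    and per: "\<And>h x. h \<in> H \<Longrightarrow> \<psi> h (x + h) = \<psi> h x"
    and nonneg: "\<And>h x. h \<in> H \<Longrightarrow> \<psi> h x \<ge> 0"
    and sum: "\<And>x. (\<Sum>h\<in>H. \<psi> h x) = f x" and f: "\<And>x. f x \<in> {0, 1}"
  obtains D where "D > 0" "\<And>x. \<exists>h. h \<noteq> 0 \<and> (\<forall>v. f (x + D \<cdot> (v + h)) = f (x + D \<cdot> v))"
proof -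
  have per': "\<psi> h (x + n \<cdot> h) = \<psi> h x" if "h \<in> H" for h x n
    using per[OF that] by (rule period_multiple)
  have le_f: "\<psi> h x \<le> f x" if "h \<in> H" for h x
    using member_le_sum[of h H "\<lambda>h. \<psi> h x"] that nonneg \<open>finite H\<close> sum by auto
  have f_le: "f x \<le> 1" for x using f[of x] by auto
  have le_1: "\<psi> h x \<le> 1" if "h \<in> H" for h x
    using le_f[OF that] f_le by (rule order_trans)
  \<comment> \<open>\<open>D0 \<int>\<^sup>2\<close> lies in the lattice spanned by any two of the periods, by Cramer's rule.\<close>
  define D0 where "D0 = (\<Prod>p \<in> {p \<in> H \<times> H. fst p \<noteq> snd p}. \<bar>det2 (fst p) (snd p)\<bar>)"
  have "D0 > 0"
    unfolding D0_def
  proof (rule prod_pos)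
    fix p assume "p \<in> {p \<in> H \<times> H. fst p \<noteq> snd p}"
    then have "det2 (fst p) (snd p) \<noteq> 0" by (intro indep) (simp_all add: mem_Times_iff)
    then show "\<bar>det2 (fst p) (snd p)\<bar> > 0" by simp
  qed
  have D0: "\<exists>a b. D0 \<cdot> v = a \<cdot> h + b \<cdot> k" if "h \<in> H" "k \<in> H" "h \<noteq> k" for h k v
  proof -
    have "finite {p \<in> H \<times> H. fst p \<noteq> snd p}" using \<open>finite H\<close> by simp
    moreover have "(h, k) \<in> {p \<in> H \<times> H. fst p \<noteq> snd p}" using that by simp
    ultimately have "\<bar>det2 h k\<bar> dvd D0"
      unfolding D0_def using dvd_prodI[of _ "(h, k)" "\<lambda>p. \<bar>det2 (fst p) (snd p)\<bar>"] by simp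
    then obtain s where "D0 = s * det2 h k" by (metis abs_dvd_iff dvdE mult.commute)
    then have "D0 \<cdot> v = (s * det2 v k) \<cdot> h + (s * det2 h v) \<cdot> k"
      using cramer_det2[of h k v] by (metis zscale_zscale zscale_add_right)
    then show ?thesis by blast
  qed
  \<comment> \<open>On a coset of \<open>D0 \<int>\<^sup>2\<close> the function \<open>\<psi> h\<close> has at most one positive value: on the lines in
    direction \<open>h\<close> through \<open>x\<close> and through \<open>x + D0 v\<close> the other summands add up to constants, and
    modulo the period \<open>k\<close> of the summand \<open>\<psi> k\<close> the second line is a shift of the first by \<open>\<alpha> k\<close> steps.\<close>
  have two_valued: "\<psi> h x = \<psi> h (x + D0 \<cdot> v)"
    if h: "h \<in> H" and pos: "\<psi> h x > 0" "\<psi> h (x + D0 \<cdot> v) > 0" for h x v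
  proof -
    have line: "(\<Sum>k\<in>H - {h}. \<psi> k (y + n \<cdot> h)) = 1 - \<psi> h y" if "\<psi> h y > 0" for y n
    proof -
      have "\<psi> h (y + n \<cdot> h) = \<psi> h y" using per' h by blast
      moreover from this have "f (y + n \<cdot> h) = 1"
        using le_f[OF h, of "y + n \<cdot> h"] f[of "y + n \<cdot> h"] that by auto
      ultimately show ?thesis
        using sum[of "y + n \<cdot> h"] sum.remove[OF \<open>finite H\<close> h, of "\<lambda>k. \<psi> k (y + n \<cdot> h)"] by simp
    qed
    have "\<forall>k\<in>H - {h}. \<exists>a b. D0 \<cdot> v = a \<cdot> h + b \<cdot> k" using D0 h by blast
    then obtain \<alpha> where \<alpha>: "\<forall>k\<in>H - {h}. \<exists>b. D0 \<cdot> v = \<alpha> k \<cdot> h + b \<cdot> k"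
      by (metis (no_types, lifting))
    let ?g = "\<lambda>k n. \<psi> k (x + n \<cdot> h)"
    have "\<psi> h x - \<psi> h (x + D0 \<cdot> v) = 0"
    proof (rule bounded_coboundary_sum_eq_0[of "H - {h}" ?g 1 \<alpha>])
      show "\<bar>?g k n\<bar> \<le> 1" if "k \<in> H - {h}" for k n
        using that nonneg[of k "x + n \<cdot> h"] le_1[of k "x + n \<cdot> h"] by auto
      show "(\<Sum>k\<in>H - {h}. ?g k (n + \<alpha> k) - ?g k n) = \<psi> h x - \<psi> h (x + D0 \<cdot> v)" for n
      proof -
        have shift: "?g k (n + \<alpha> k) = \<psi> k (x + D0 \<cdot> v + n \<cdot> h)" if "k \<in> H - {h}" for k
        proof -
          from \<alpha> that obtain b where b: "D0 \<cdot> v = \<alpha> k \<cdot> h + b \<cdot> k" by blast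
          have eq: "x + D0 \<cdot> v + n \<cdot> h = (x + (n + \<alpha> k) \<cdot> h) + b \<cdot> k"
            unfolding b by (simp add: zscale_add_left algebra_simps)
          have "k \<in> H" using that by simp
          then show ?thesis by (simp only: eq per')
        qed
        have "(\<Sum>k\<in>H - {h}. ?g k (n + \<alpha> k) - ?g k n)
            = (\<Sum>k\<in>H - {h}. \<psi> k (x + D0 \<cdot> v + n \<cdot> h)) - (\<Sum>k\<in>H - {h}. \<psi> k (x + n \<cdot> h))"
          using shift by (simp add: sum_subtractf)
        then show ?thesis using line[OF pos(1)] line[OF pos(2)] by simp
      qed
    qed (use \<open>finite H\<close> in auto)
    then show ?thesis by simp
  qed
  have fin_range: "finite (range (\<psi> h))" if h: "h \<in> H" for h
  proof -
    let ?R = "{0..<D0} \<times> {0..<D0}"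
    have "finite (range (\<lambda>v. \<psi> h (r + D0 \<cdot> v)))" for r
    proof (cases "\<exists>w. \<psi> h (r + D0 \<cdot> w) > 0")
      case True
      then obtain w where w: "\<psi> h (r + D0 \<cdot> w) > 0" by blast
      have "\<psi> h (r + D0 \<cdot> v) \<in> {0, \<psi> h (r + D0 \<cdot> w)}" for v
      proof (cases "\<psi> h (r + D0 \<cdot> v) > 0")
        case True
        have eq: "r + D0 \<cdot> v = r + D0 \<cdot> w + D0 \<cdot> (v - w)" by (simp add: zscale_diff_right)
        have "\<psi> h (r + D0 \<cdot> w) = \<psi> h (r + D0 \<cdot> v)"
          unfolding eq by (rule two_valued[OF h w True[unfolded eq]])
        then show ?thesis by simp
      qed (use nonneg[OF h] in \<open>simp add: less_le\<close>)
      then have "range (\<lambda>v. \<psi> h (r + D0 \<cdot> v)) \<subseteq> {0, \<psi> h (r + D0 \<cdot> w)}" by blast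
      then show ?thesis by (rule finite_subset) simp
    next
      case False
      then have "\<not> \<psi> h (r + D0 \<cdot> v) > 0" for v by blast
      then have "\<psi> h (r + D0 \<cdot> v) = 0" for v using nonneg[OF h, of "r + D0 \<cdot> v"] by (simp add: less_le)
      then show ?thesis by simp
    qed
    then have "finite (\<Union>r\<in>?R. range (\<lambda>v. \<psi> h (r + D0 \<cdot> v)))" by blast
    moreover have "range (\<psi> h) \<subseteq> (\<Union>r\<in>?R. range (\<lambda>v. \<psi> h (r + D0 \<cdot> v)))"
    proof
      fix y assume "y \<in> range (\<psi> h)"
      then obtain x where "y = \<psi> h x" by blast
      define r v where "r = (fst x mod D0, snd x mod D0)" and "v = (fst x div D0, snd x div D0)"
      have "x = r + D0 \<cdot> v" by (simp add: r_def v_def prod_eq_iff)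
      then have "y = \<psi> h (r + D0 \<cdot> v)" using \<open>y = \<psi> h x\<close> by (simp only:)
      moreover have "r \<in> ?R" using \<open>D0 > 0\<close> by (simp add: r_def)
      ultimately show "y \<in> (\<Union>r\<in>?R. range (\<lambda>v. \<psi> h (r + D0 \<cdot> v)))" by blast
    qed
    ultimately show ?thesis by (rule finite_subset[rotated])
  qed
  \<comment> \<open>The sum \<open>f\<close> is integral, so \<open>\<psi> h\<close> is, modulo \<open>1\<close>, minus the sum of the other summands.\<close>
  have "\<exists>P>0. \<forall>x v. \<psi> h (x + P \<cdot> v) - \<psi> h x \<in> \<int>" if h: "h \<in> H" for h
  proof (rule finite_range_periodic_mod_one[of "H - {h}" h "\<psi> h" \<psi>])
    show "\<psi> h x + (\<Sum>k\<in>H - {h}. \<psi> k x) \<in> \<int>" for x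
      using sum.remove[OF \<open>finite H\<close> h, of "\<lambda>k. \<psi> k x"] sum[of x] f[of x] by auto
    show "finite (H - {h})" using \<open>finite H\<close> by simp
    show "det2 h k \<noteq> 0" if "k \<in> H - {h}" for k using that h by (intro indep) auto
    show "finite (range (\<psi> h))" using h by (rule fin_range)
    show "\<psi> h (x + h) = \<psi> h x" for x using h by (rule per)
    show "\<psi> k (x + k) = \<psi> k x" if "k \<in> H - {h}" for k x using that by (intro per) simp
  qed
  then obtain P where P: "\<And>h. h \<in> H \<Longrightarrow> P h > 0"
    "\<And>h x v. h \<in> H \<Longrightarrow> \<psi> h (x + P h \<cdot> v) - \<psi> h x \<in> \<int>"
    using bchoice[of H "\<lambda>h P. P > 0 \<and> (\<forall>x v. \<psi> h (x + P \<cdot> v) - \<psi> h x \<in> \<int>)"] by blast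
  define Q where "Q = (\<Prod>h\<in>H. P h)"
  have "Q > 0" unfolding Q_def using P(1) by (intro prod_pos) auto
  have Q: "\<psi> h (x + Q \<cdot> v) - \<psi> h x \<in> \<int>" if "h \<in> H" for h x v
  proof -
    have "P h dvd Q" unfolding Q_def using that \<open>finite H\<close> by (intro dvd_prodI) auto
    then obtain s where "Q = P h * s" by blast
    then have "Q \<cdot> v = P h \<cdot> s \<cdot> v" by simp
    then show ?thesis using P(2)[OF that] by metis
  qed
  define D where "D = D0 * Q"
  show thesis
  proof (rule that)
    show "D > 0" using \<open>D0 > 0\<close> \<open>Q > 0\<close> by (simp add: D_def)
    fix x
    have int_diff: "\<psi> h (x + D \<cdot> v) - \<psi> h (x + D \<cdot> w) \<in> \<int>" if "h \<in> H" for h v w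
    proof -
      have "x + D \<cdot> v = (x + D \<cdot> w) + Q \<cdot> (D0 \<cdot> (v - w))"
        by (simp add: D_def prod_eq_iff algebra_simps)
      then show ?thesis using Q[OF that] by metis
    qed
    show "\<exists>h. h \<noteq> 0 \<and> (\<forall>v. f (x + D \<cdot> (v + h)) = f (x + D \<cdot> v))"
    proof (cases "\<exists>h\<in>H. \<exists>w. \<psi> h (x + D \<cdot> w) = 1")
      case True
      then obtain h w where h: "h \<in> H" and w: "\<psi> h (x + D \<cdot> w) = 1" by blast
      \<comment> \<open>The line in direction \<open>h\<close> through the point where \<open>\<psi> h\<close> is \<open>1\<close> meets every line in
        direction \<open>k\<close> through the coset, and at the meeting point there is no room left for \<open>\<psi> k\<close>.\<close>
      have vanish: "\<psi> k (x + D \<cdot> v) = 0" if k: "k \<in> H" "k \<noteq> h" for k v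
      proof -
        obtain a b where ab: "D0 \<cdot> (Q \<cdot> (v - w)) = a \<cdot> h + b \<cdot> k" using D0[OF h k(1)] k(2) by metis
        let ?y = "x + D \<cdot> w + a \<cdot> h"
        have eq: "x + D \<cdot> v = ?y + b \<cdot> k"
        proof -
          have "x + D \<cdot> v = x + D \<cdot> w + D0 \<cdot> (Q \<cdot> (v - w))"
            by (simp add: D_def prod_eq_iff algebra_simps)
          then show ?thesis by (simp only: ab add.assoc)
        qed
        have "(\<Sum>j\<in>{h, k}. \<psi> j ?y) \<le> (\<Sum>j\<in>H. \<psi> j ?y)"
          using h k nonneg \<open>finite H\<close> by (intro sum_mono2) auto
        moreover have "\<psi> h ?y = 1" using per'[OF h] w by simp
        ultimately have "\<psi> k ?y \<le> 0" using k(2) sum[of ?y] f_le[of ?y] by auto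
        then show ?thesis unfolding eq per'[OF k(1)] using nonneg[OF k(1), of ?y] by simp
      qed
      have f_eq: "f (x + D \<cdot> v) = \<psi> h (x + D \<cdot> v)" for v
        using sum.remove[OF \<open>finite H\<close> h, of "\<lambda>k. \<psi> k (x + D \<cdot> v)"] sum[of "x + D \<cdot> v"] vanish by simp
      have "f (x + D \<cdot> (v + h)) = f (x + D \<cdot> v)" for v
        unfolding f_eq using per'[OF h, of "x + D \<cdot> v" D] by (simp add: zscale_add_right add.assoc)
      then show ?thesis using h \<open>0 \<notin> H\<close> by (intro exI[of _ h]) auto
    next
      case False
      \<comment> \<open>Now all summands take values in \<open>[0, 1)\<close> on the coset and are constant modulo \<open>1\<close>, hence
        constant; any non-zero vector serves as the period.\<close>
      have "\<psi> h (x + D \<cdot> (v + (1, 0))) = \<psi> h (x + D \<cdot> v)" if h: "h \<in> H" for h v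
      proof -
        have "\<psi> h (x + D \<cdot> w) < 1" for w using False le_1[OF h] h by (meson less_le)
        moreover have "\<psi> h (x + D \<cdot> w) \<ge> 0" for w using nonneg[OF h] .
        ultimately have "\<bar>\<psi> h (x + D \<cdot> (v + (1, 0))) - \<psi> h (x + D \<cdot> v)\<bar> < 1"
          by (smt (verit))
        then show ?thesis using int_diff[OF h] Ints_eq_abs_less1 by (metis Ints_0 diff_0_right right_minus_eq)
      qed
      then have "f (x + D \<cdot> (v + (1, 0))) = f (x + D \<cdot> v)" for v
        unfolding sum[symmetric] by (intro sum.cong) auto
      then show ?thesis by (intro exI[of _ "(1, 0)"]) (auto simp: zero_prod_def)
    qed
  qed
qed

section \<open>Level one tilings of periodic sets\<close>

text \<open>The pieces are the intersections with the \<open>D\<^sup>2\<close> cosets of \<open>D \<int>\<^sup>2\<close>, numbered by a bijection.\<close>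

lemma weakly_periodicI_cosets:
  assumes "D > 0" and per: "\<And>x. \<exists>h. h \<noteq> 0 \<and> (\<forall>v. x + D \<cdot> (v + h) \<in> A \<longleftrightarrow> x + D \<cdot> v \<in> A)"
  shows "weakly_periodic A"
proof -
  define res where "res x = (fst x mod D, snd x mod D)" for x :: lattice
  let ?R = "{0..<D} \<times> {0..<D}"
  have res_in: "res x \<in> ?R" for x using \<open>D > 0\<close> by (simp add: res_def)
  have res_shift: "res (x + D \<cdot> v) = res x" for x v by (simp add: res_def)
  have res_eq: "\<exists>v. y = x + D \<cdot> v" if eq: "res x = res y" for x y
  proof -
    obtain a b where "fst y - fst x = D * a" "snd y - snd x = D * b"
      using eq by (metis res_def prod.inject mod_eq_dvd_iff dvdE)
    then have "y = x + D \<cdot> (a, b)" by (simp add: prod_eq_iff)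
    then show ?thesis ..
  qed
  obtain e where e: "bij_betw e ?R {0..<card ?R}"
    using ex_bij_betw_finite_nat[of ?R] by auto
  define T where "T j = {x \<in> A. Suc (e (res x)) = j}" for j
  have "e (res x) < card ?R" for x using bij_betw_apply[OF e res_in] by simp
  then have "A = (\<Union>j\<in>{1..card ?R}. T j)" by (fastforce simp: T_def Suc_le_eq)
  moreover have "disjoint_family_on T {1..card ?R}" by (auto simp: disjoint_family_on_def T_def)
  moreover have "\<exists>h. h \<noteq> 0 \<and> periodic_wrt (multiples h) (T j)" for j
  proof (cases "T j = {}")
    case True
    then show ?thesis by (intro exI[of _ "(1, 0)"]) (auto simp: periodic_wrt_def zero_prod_def)
  next
    case False
    then obtain x where x: "x \<in> T j" by blast
    obtain h where h: "h \<noteq> 0" "\<And>v. x + D \<cdot> (v + h) \<in> A \<longleftrightarrow> x + D \<cdot> v \<in> A" using per by blast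
    have A: "y + n \<cdot> D \<cdot> h \<in> A \<longleftrightarrow> y \<in> A" if y: "res y = res x" for y n
    proof -
      obtain v where v: "y = x + D \<cdot> v" using res_eq[of x y] y by auto
      have "y + n \<cdot> D \<cdot> h = x + D \<cdot> (v + n \<cdot> h)" by (simp add: v prod_eq_iff algebra_simps)
      then show ?thesis
        using period_multiple[where g = "\<lambda>v. x + D \<cdot> v \<in> A" and h = h, OF h(2), of v n] v by metis
    qed
    have inj: "res y = res x" if "e (res y) = e (res x)" for y
      using that e res_in by (meson bij_betw_def inj_onD)
    have "y + n \<cdot> D \<cdot> h \<in> T j \<longleftrightarrow> y \<in> T j" for y n
    proof -
      have "res (y + n \<cdot> D \<cdot> h) = res y" using res_shift[of y "n \<cdot> h"] by (simp add: mult.commute)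
      then show ?thesis using x A[of y n] inj[of y] by (auto simp: T_def)
    qed
    then have "periodic_wrt (multiples (D \<cdot> h)) (T j)"
      by (auto simp: periodic_wrt_def multiples_def indicator_def zscale_def)
    then show ?thesis using h(1) \<open>D > 0\<close> by (intro exI[of _ "D \<cdot> h"]) auto
  qed
  ultimately show ?thesis unfolding weakly_periodic_def by (intro exI[of _ "card ?R"] exI[of _ T]) auto
qed

lemma conv_indicator:
  assumes "finite F"
  shows "conv (indicator F) g x = (\<Sum>f\<in>F. g (x - f))"
proof -
  have "{y. (indicator F y :: int) \<noteq> 0} = F" by (auto simp: indicator_def)
  then show ?thesis unfolding conv_def by (simp add: indicator_def)
qed

text \<open>
  Instead of \<open>A\<close>, the set \<open>E\<close> is shifted to compensate for the translation of \<open>F\<close> to a set containing \<open>0\<close>.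
  The final modulus is \<open>D N\<close>, as both \<open>1\<^sub>E - 1\<^sub>A\<close> and \<open>1\<^sub>E\<close> have to be controlled on the cosets.
\<close>

lemma level_one_tiling_weakly_periodic:
  assumes "finite F" "F \<noteq> {}" "periodic E" and tiling: "level_tiling 1 F E A"
  shows "weakly_periodic A"
proof -
  obtain f0 where f0: "f0 \<in> F" using \<open>F \<noteq> {}\<close> by blast
  define G where "G = (\<lambda>f. f - f0) ` F"
  define a :: "lattice \<Rightarrow> int" where "a = indicator A"
  define e :: "lattice \<Rightarrow> int" where "e x = indicator E (x + f0)" for x
  have G: "finite G" "0 \<in> G" using \<open>finite F\<close> f0 by (auto simp: G_def image_iff)
  obtain N where "N > 0" and N: "\<And>x v. x + N \<cdot> v \<in> E \<longleftrightarrow> x \<in> E"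
    by (rule periodic_common_multiple[OF \<open>periodic E\<close>]) (rule that)
  have a: "a x \<in> {0..1}" for x by (simp add: a_def indicator_def)
  have e_per: "e (x + N \<cdot> v) = e x" for x v
    using N[of "x + f0" v] by (simp add: e_def indicator_def algebra_simps)
  have "(\<Sum>g\<in>G. a (x - g)) = e x" for x
  proof -
    have "(\<Sum>g\<in>G. a (x - g)) = (\<Sum>f\<in>F. a (x + f0 - f))"
      unfolding G_def by (subst sum.reindex) (auto simp: inj_on_def algebra_simps)
    also have "\<dots> = conv (indicator F) (indicator A) (x + f0)"
      by (simp add: conv_indicator \<open>finite F\<close> a_def)
    finally show ?thesis using tiling by (simp add: level_tiling_def e_def)
  qed
  note dilated = tiling_dilation[OF G(1) \<open>N > 0\<close> e_per a this]
  define q where "q = N * fact (card G)"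
  have "q \<noteq> 0" using \<open>N > 0\<close> by (simp add: q_def)
  obtain \<phi> :: "lattice \<Rightarrow> lattice \<Rightarrow> real" where \<phi>: "\<And>f x. \<phi> f (x + q \<cdot> f) = \<phi> f x" "\<And>f x. \<phi> f x \<ge> 0"
    "\<And>x. (\<Sum>f\<in>G - {0}. \<phi> f x) = real_of_int (e x - a x)"
    using dilation_average[OF G a dilated, folded q_def] by blast
  have "\<exists>H \<psi>. finite H \<and> 0 \<notin> H \<and> (\<forall>h\<in>H. \<forall>k\<in>H. h \<noteq> k \<longrightarrow> det2 h k \<noteq> 0)
    \<and> (\<forall>h\<in>H. \<forall>x. \<psi> h (x + h) = \<psi> h x \<and> \<psi> h x \<ge> 0)
    \<and> (\<forall>x. (\<Sum>h\<in>H. \<psi> h x) = (\<Sum>f\<in>G - {0}. \<phi> f x))"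
    by (rule merge_parallel_periods[where p = "\<lambda>f. q \<cdot> f"]) (use G(1) \<open>q \<noteq> 0\<close> \<phi>(1,2) in auto)
  then obtain H \<psi> where H: "finite H" "0 \<notin> H" "\<forall>h\<in>H. \<forall>k\<in>H. h \<noteq> k \<longrightarrow> det2 h k \<noteq> 0"
    and \<psi>: "\<forall>h\<in>H. \<forall>x. \<psi> h (x + h) = \<psi> h x \<and> \<psi> h x \<ge> 0"
    and sum: "\<forall>x. (\<Sum>h\<in>H. \<psi> h x) = (\<Sum>f\<in>G - {0}. \<phi> f x)"
    by (elim exE conjE) (rule that)
  define f where "f x = real_of_int (e x - a x)" for x
  have f: "f x \<in> {0, 1}" for x
  proof -
    have "f x \<ge> 0" unfolding f_def \<phi>(3)[symmetric] by (intro sum_nonneg \<phi>(2))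
    then show ?thesis by (auto simp: f_def e_def a_def indicator_def split: if_splits)
  qed
  obtain D where D: "D > 0" "\<And>x. \<exists>h. h \<noteq> 0 \<and> (\<forall>v. f (x + D \<cdot> (v + h)) = f (x + D \<cdot> v))"
  proof (rule zero_one_sum_coset_periodic[of H \<psi> f])
    show "(\<Sum>h\<in>H. \<psi> h x) = f x" for x
      unfolding f_def \<phi>(3)[symmetric] using sum by blast
    show "det2 h k \<noteq> 0" if "h \<in> H" "k \<in> H" "h \<noteq> k" for h k using H(3) that by blast
    show "\<psi> h (x + h) = \<psi> h x" if "h \<in> H" for h x using \<psi> that by blast
    show "\<psi> h x \<ge> 0" if "h \<in> H" for h x using \<psi> that by blast
    show "f x \<in> {0, 1}" for x by (rule f)
    show "finite H" by (rule H(1))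
    show "0 \<notin> H" by (rule H(2))
  qed (rule that)
  show ?thesis
  proof (rule weakly_periodicI_cosets)
    show "D * N > 0" using D(1) \<open>N > 0\<close> by simp
    fix x
    obtain h where h: "h \<noteq> 0" "\<And>v. f (x + D \<cdot> (v + h)) = f (x + D \<cdot> v)" using D(2) by blast
    have "x + (D * N) \<cdot> (v + h) \<in> A \<longleftrightarrow> x + (D * N) \<cdot> v \<in> A" for v
    proof -
      have "f (x + D \<cdot> (N \<cdot> v + N \<cdot> h)) = f (x + D \<cdot> N \<cdot> v)"
        by (rule period_multiple[where g = "\<lambda>v. f (x + D \<cdot> v)"]) (rule h(2))
      then have "f (x + (D * N) \<cdot> (v + h)) = f (x + (D * N) \<cdot> v)"
        by (simp add: zscale_add_right)
      moreover have "e (x + (D * N) \<cdot> w) = e x" for w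
        using e_per[of x "D \<cdot> w"] by (simp add: mult.commute)
      ultimately have "a (x + (D * N) \<cdot> (v + h)) = a (x + (D * N) \<cdot> v)"
        by (simp add: f_def)
      then show ?thesis by (auto simp: a_def indicator_def split: if_splits)
    qed
    then show "\<exists>h. h \<noteq> 0 \<and> (\<forall>v. x + (D * N) \<cdot> (v + h) \<in> A \<longleftrightarrow> x + (D * N) \<cdot> v \<in> A)"
      using h(1) by blast
  qed
qed

section \<open>A level four tiling that is not weakly periodic\<close>

text \<open>
  Consider the line \<open>s \<mapsto> (X + p s, Y + q s)\<close> in the torus. At \<open>s = - X / p\<close> its first coordinate
  is an integer, and by assumption the second is not. Moving \<open>s\<close> slightly to the side where \<open>p s\<close>
  decreases makes the first fractional part almost \<open>1\<close> and hardly changes the second, which is positive: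
  the sum then exceeds \<open>1\<close>. The integer multiples of \<open>\<theta>\<close> are dense modulo \<open>1\<close> and reach such an \<open>s\<close>.
\<close>

lemma frac_sum_ge_1_on_line:
  fixes X Y \<theta> :: real and p q :: int
  assumes "\<theta> \<notin> \<rat>" "p \<noteq> 0" and nonint: "Y - of_int q * X / of_int p \<notin> \<int>"
  obtains k :: int where "frac (X + of_int p * (of_int k * \<theta>)) + frac (Y + of_int q * (of_int k * \<theta>)) \<ge> 1"
proof -
  define \<delta> where "\<delta> = - X / of_int p"
  define Y0 where "Y0 = Y + of_int q * \<delta>"
  define \<eta> where "\<eta> = frac Y0"
  have X: "X + of_int p * \<delta> = 0" using \<open>p \<noteq> 0\<close> by (simp add: \<delta>_def)
  have "Y0 \<notin> \<int>" using nonint by (simp add: Y0_def \<delta>_def)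
  then have \<eta>: "0 < \<eta>" "\<eta> < 1" unfolding \<eta>_def by (auto simp: frac_lt_1)
  define \<mu> where "\<mu> = min \<eta> (1 - \<eta>)"
  have \<mu>: "0 < \<mu>" "\<mu> \<le> \<eta>" "\<mu> \<le> 1 - \<eta>" using \<eta> by (auto simp: \<mu>_def)
  define M :: real where "M = \<bar>of_int p\<bar> + \<bar>of_int q\<bar>"
  have "M > 0" using \<open>p \<noteq> 0\<close> by (simp add: M_def add_pos_nonneg)
  define \<kappa> where "\<kappa> = \<mu> / M"
  have "\<kappa> > 0" using \<mu> \<open>M > 0\<close> by (simp add: \<kappa>_def)
  obtain i k where ik: "\<bar>of_int k * \<theta> - of_int i - (\<delta> - of_int (sgn p) * (\<kappa> / 2))\<bar> < \<kappa> / 2"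
    using sequence_of_fractional_parts_is_dense[OF \<open>\<theta> \<notin> \<rat>\<close>, of "\<kappa> / 2" "\<delta> - of_int (sgn p) * (\<kappa> / 2)"]
      \<open>\<kappa> > 0\<close> by (metis half_gt_zero)
  define \<tau> where "\<tau> = of_int k * \<theta> - of_int i - \<delta>"
  have sgn: "(p > 0 \<and> sgn p = 1) \<or> (p < 0 \<and> sgn p = -1)" using \<open>p \<noteq> 0\<close> by (auto simp: sgn_if)
  have \<tau>: "\<bar>\<tau>\<bar> < \<kappa>" "of_int p * \<tau> < 0"
  proof -
    have *: "\<bar>\<tau> + of_int (sgn p) * (\<kappa> / 2)\<bar> < \<kappa> / 2" using ik by (simp add: \<tau>_def algebra_simps)
    from sgn * show "\<bar>\<tau>\<bar> < \<kappa>" by (auto simp: abs_if split: if_splits)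
    from sgn * show "of_int p * \<tau> < 0" by (auto simp: mult_less_0_iff abs_if split: if_splits)
  qed
  have "\<bar>of_int p * \<tau>\<bar> + \<bar>of_int q * \<tau>\<bar> = M * \<bar>\<tau>\<bar>" by (simp add: M_def abs_mult algebra_simps)
  also have "\<dots> < \<mu>"
    using mult_strict_left_mono[OF \<tau>(1) \<open>M > 0\<close>] \<open>M > 0\<close> by (simp add: \<kappa>_def)
  finally have small: "\<bar>of_int p * \<tau>\<bar> + \<bar>of_int q * \<tau>\<bar> < \<mu>" .
  have k\<theta>: "of_int k * \<theta> = \<delta> + \<tau> + of_int i" by (simp add: \<tau>_def)
  have "frac (X + of_int p * (of_int k * \<theta>)) = 1 + of_int p * \<tau>"
  proof (subst frac_unique_iff, intro conjI)
    have "X + of_int p * (of_int k * \<theta>) - (1 + of_int p * \<tau>) = of_int (p * i - 1)"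
      using X unfolding k\<theta> by (simp add: algebra_simps)
    then show "X + of_int p * (of_int k * \<theta>) - (1 + of_int p * \<tau>) \<in> \<int>" by (metis Ints_of_int)
  qed (use small \<mu> \<eta> \<tau> in linarith)+
  moreover have "frac (Y + of_int q * (of_int k * \<theta>)) = \<eta> + of_int q * \<tau>"
  proof (subst frac_unique_iff, intro conjI)
    have "Y + of_int q * (of_int k * \<theta>) - (\<eta> + of_int q * \<tau>) = of_int (\<lfloor>Y0\<rfloor> + q * i)"
      unfolding k\<theta> \<eta>_def frac_def by (simp add: Y0_def algebra_simps)
    then show "Y + of_int q * (of_int k * \<theta>) - (\<eta> + of_int q * \<tau>) \<in> \<int>" by (metis Ints_of_int)
  qed (use small \<mu> \<eta> \<tau> in linarith)+
  ultimately have "frac (X + of_int p * (of_int k * \<theta>)) + frac (Y + of_int q * (of_int k * \<theta>)) \<ge> 1"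
    using small \<mu> by linarith
  then show thesis by (rule that)
qed

text \<open>
  The inequality says that the carry is \<open>1\<close>. Exchanging the two values of the carry on the points
  with odd coordinate sum encodes the sign \<open>(-1) ^ (n + m)\<close>.
\<close>

definition carry_set :: "real \<Rightarrow> lattice set" where
  "carry_set \<alpha> = {(n, m). even (n + m) \<longleftrightarrow> frac (2 * \<alpha> * of_int n) + frac (\<alpha> * of_int m) \<ge> 1}"

text \<open>The eight subset sums of \<open>(0, 1)\<close>, \<open>(1, 0)\<close> and \<open>(1, -2)\<close>.\<close>

definition carry_tile :: "lattice set" where
  "carry_tile = {(0,0), (1,0), (0,1), (1,1), (1,-2), (2,-2), (1,-1), (2,-1)}"

lemma carry_set_tiling: "level_tiling 4 carry_tile UNIV (carry_set \<alpha>)"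
proof -
  define \<sigma> where "\<sigma> n m = (if even n = even m then 1 else - 1 :: real)" for n m :: int
  define u where "u n = frac (2 * \<alpha> * of_int n)" for n :: int
  define v where "v m = frac (\<alpha> * of_int m)" for m :: int
  have ind: "real_of_int (indicator (carry_set \<alpha>) (n, m)) = 1/2 + \<sigma> n m * (u n + v m - v (2 * n + m) - 1/2)" for n m
  proof -
    have "2 * \<alpha> * of_int n + \<alpha> * of_int m = \<alpha> * of_int (2 * n + m)" by (simp add: algebra_simps)
    then have "v (2 * n + m) = (if u n + v m < 1 then u n + v m else u n + v m - 1)"
      unfolding u_def v_def by (metis frac_add)
    then show ?thesis by (auto simp: carry_set_def indicator_def \<sigma>_def u_def v_def)
  qed
  have "conv (indicator carry_tile) (indicator (carry_set \<alpha>)) (n, m) = 4" for n m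
  proof -
    have "real_of_int (conv (indicator carry_tile) (indicator (carry_set \<alpha>)) (n, m)) = 4"
      by (simp add: conv_indicator carry_tile_def ind \<sigma>_def algebra_simps)
    then show ?thesis by linarith
  qed
  then show ?thesis by (auto simp: level_tiling_def fun_eq_iff)
qed

lemma irrational_times_rational:
  fixes \<alpha> r :: real
  assumes "\<alpha> \<notin> \<rat>" "r \<in> \<rat>" "r \<noteq> 0"
  shows "\<alpha> * r \<notin> \<rat>"
  using assms Rats_divide[of "\<alpha> * r" r] by auto

text \<open>
  Only finitely many periods \<open>h j\<close> occur, so a point can be chosen that is parallel to none of them.
  The points \<open>(t, 1)\<close> and \<open>(- t, -1)\<close>, with \<open>t\<close> even and large, have odd coordinate sum and opposite
  carries, so one of them belongs to the set. Along its period \<open>2 h j\<close>, which preserves the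
  parity, the carry would have to remain \<open>0\<close>, contrary to \<open>frac_sum_ge_1_on_line\<close>.
\<close>

lemma carry_set_not_weakly_periodic:
  assumes \<alpha>: "\<alpha> \<notin> \<rat>"
  shows "\<not> weakly_periodic (carry_set \<alpha>)"
proof
  assume "weakly_periodic (carry_set \<alpha>)"
  then obtain r T where A: "carry_set \<alpha> = (\<Union>j\<in>{1..r::nat}. T j)"
    and "\<forall>j\<in>{1..r}. \<exists>h. h \<noteq> 0 \<and> periodic_wrt (multiples h) (T j)"
    unfolding weakly_periodic_def by blast
  then obtain h where h: "\<And>j. j \<in> {1..r} \<Longrightarrow> h j \<noteq> 0"
    "\<And>j. j \<in> {1..r} \<Longrightarrow> periodic_wrt (multiples (h j)) (T j)" by metis
  define t where "t = 2 * (1 + (\<Sum>j\<in>{1..r}. \<bar>fst (h j)\<bar>))"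
  have t: "\<bar>fst (h j)\<bar> < t" if "j \<in> {1..r}" for j
    using member_le_sum[OF that, of "\<lambda>j. \<bar>fst (h j)\<bar>"] by (simp add: t_def)
  have "even t" by (simp add: t_def)
  have "t > 0" by (simp add: t_def add_pos_nonneg sum_nonneg)
  have irr: "\<alpha> * of_int n \<notin> \<int>" if "n \<noteq> 0" for n
    using irrational_times_rational[OF \<alpha>, of "of_int n"] that Ints_subset_Rats by auto
  obtain s :: int where s: "s = 1 \<or> s = -1" "(s * t, s) \<in> carry_set \<alpha>"
  proof (cases "(t, 1) \<in> carry_set \<alpha>")
    case True
    then show ?thesis using that[of 1] by simp
  next
    case False
    let ?u = "2 * \<alpha> * of_int t"
    have "?u \<notin> \<int>" "\<alpha> \<notin> \<int>" "?u + \<alpha> \<notin> \<int>"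
      using irr[of "2 * t"] irr[of 1] irr[of "2 * t + 1"] \<open>t > 0\<close> by (simp_all add: algebra_simps)
    moreover have "frac ?u + frac \<alpha> \<noteq> 1"
    proof
      assume "frac ?u + frac \<alpha> = 1"
      then have "?u + \<alpha> = of_int (\<lfloor>?u\<rfloor> + \<lfloor>\<alpha>\<rfloor> + 1)" by (simp add: frac_def)
      then show False using \<open>?u + \<alpha> \<notin> \<int>\<close> by (metis Ints_of_int)
    qed
    ultimately have "(- t, -1) \<in> carry_set \<alpha>"
      using False \<open>even t\<close> by (simp add: carry_set_def frac_neg)
    then show ?thesis using that[of "-1"] by simp
  qed
  then obtain j where j: "j \<in> {1..r}" "(s * t, s) \<in> T j" using A by auto
  obtain a b where ab: "h j = (a, b)" by fastforce
  have line: "frac (2 * \<alpha> * of_int (s * t + 2 * k * a)) + frac (\<alpha> * of_int (s + 2 * k * b)) < 1" for k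
  proof -
    have "(2 * k * a, 2 * k * b) \<in> multiples (h j)" by (force simp: multiples_def ab)
    then have "(indicator (T j) ((s * t, s) + (2 * k * a, 2 * k * b)) :: int) = indicator (T j) (s * t, s)"
      using h(2)[OF j(1)] unfolding periodic_wrt_def by blast
    then have "(s * t + 2 * k * a, s + 2 * k * b) \<in> carry_set \<alpha>"
      using j A by (auto simp: indicator_def split: if_splits)
    then show ?thesis using s(1) \<open>even t\<close> by (auto simp: carry_set_def)
  qed
  have nonparallel: "t * b \<noteq> a"
  proof
    assume eq: "t * b = a"
    then have "b \<noteq> 0" using h(1)[OF j(1)] by (auto simp: ab zero_prod_def)
    then have "t \<le> \<bar>t * b\<bar>" using \<open>t > 0\<close> by (simp add: abs_mult)
    then show False using t[OF j(1)] eq by (simp add: ab)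
  qed
  have irr2: "2 * \<alpha> \<notin> \<rat>" using irrational_times_rational[OF \<alpha>, of 2] by (simp add: mult.commute)
  show False
  proof (cases "a = 0")
    case True
    then have "b \<noteq> 0" using nonparallel by auto
    \<comment> \<open>The first coordinate is constant along the line; \<open>frac_sum_ge_1_on_line\<close> applies with the two
      coordinates exchanged.\<close>
    have "2 * \<alpha> * of_int (s * t) - of_int 0 * (\<alpha> * of_int s) / of_int b \<notin> \<int>"
      using irr[of "2 * (s * t)"] s(1) \<open>t > 0\<close> by (auto simp: algebra_simps)
    from frac_sum_ge_1_on_line[OF irr2 \<open>b \<noteq> 0\<close> this] obtain k where
      "frac (\<alpha> * of_int s + of_int b * (of_int k * (2 * \<alpha>)))
        + frac (2 * \<alpha> * of_int (s * t) + of_int 0 * (of_int k * (2 * \<alpha>))) \<ge> 1" .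
    then show False using line[of k] True by (simp add: algebra_simps)
  next
    case False
    have "\<alpha> * of_int s - of_int b * (2 * \<alpha> * of_int (s * t)) / of_int (2 * a)
        = \<alpha> * (of_int (s * (a - t * b)) / of_int a)"
      using False by (simp add: field_simps)
    moreover have "real_of_int a \<noteq> of_int t * of_int b"
      using nonparallel by (metis of_int_eq_iff of_int_mult)
    then have "\<alpha> * (of_int (s * (a - t * b)) / of_int a) \<notin> \<rat>"
      by (intro irrational_times_rational[OF \<alpha>]) (use False s(1) in auto)
    ultimately have "\<alpha> * of_int s - of_int b * (2 * \<alpha> * of_int (s * t)) / of_int (2 * a) \<notin> \<int>"
      using Ints_subset_Rats by auto
    from frac_sum_ge_1_on_line[OF irr2 _ this] False obtain k where
      "frac (2 * \<alpha> * of_int (s * t) + of_int (2 * a) * (of_int k * (2 * \<alpha>)))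
        + frac (\<alpha> * of_int s + of_int b * (of_int k * (2 * \<alpha>))) \<ge> 1" by auto
    then show False using line[of k] by (simp add: algebra_simps)
  qed
qed

lemma exists_irrational: "\<exists>\<alpha>::real. \<alpha> \<notin> \<rat>"
  using countable_rat uncountable_UNIV_real by (metis UNIV_eq_I)

theorem theorem1p3:
  shows "(\<forall>F E A :: (int \<times> int) set.
            finite F \<and> F \<noteq> {} \<and> periodic E \<and> level_tiling 1 F E A \<longrightarrow> weakly_periodic A) \<and>
         (\<exists>F A :: (int \<times> int) set.
            card F = 8 \<and> level_tiling 4 F UNIV A \<and> \<not> weakly_periodic A)"
proof (intro conjI allI impI)
  fix F E A :: "(int \<times> int) set"
  assume "finite F \<and> F \<noteq> {} \<and> periodic E \<and> level_tiling 1 F E A"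
  then show "weakly_periodic A" using level_one_tiling_weakly_periodic by blast
next
  obtain \<alpha> :: real where "\<alpha> \<notin> \<rat>" using exists_irrational by blast
  moreover have "card carry_tile = 8" by (simp add: carry_tile_def)
  ultimately show "\<exists>F A :: (int \<times> int) set.
      card F = 8 \<and> level_tiling 4 F UNIV A \<and> \<not> weakly_periodic A"
    using carry_set_tiling carry_set_not_weakly_periodic by blast
qed

end
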